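(* Let $d\ge 1$ be an integer, $X=[0,2\pi]^d$, and let $\psi\in\Psi$. Then the Fourier partial-sum operators $s_M$ are uniformly bounded from the exponential Orlicz space $L(N[\psi])$ into the exponential Orlicz space $L(N_d[\psi])$: there is a finite constant $C=C(d,\psi)$ such that for all $f\in L(N[\psi])$ $$\sup_{M\ge 1}\|s_M[f]\|_{L(N_d[\psi])}\le C\,\|f\|_{L(N[\psi])}.$$
   Context: Fourier partial sums: for integrable $f$ on $[0,2\pi]^d$, $c(n)=(2\pi)^{-d}\int_{[0,2\pi]^d} e^{i(n,x)}f(x)\,dx$ for $n\in\mathbb Z^d$, $|n|=\max_j|n_j|$, and $s_M[f](x)=\sum_{|n|\le M}c(n)e^{-i(n,x)}$. Class $\Psi$: fix a constant $\alpha\ge 1$; $\Psi$ is the set of all continuous, positive, finite, strictly increasing functions $\psi:[\alpha,\infty)\to(0,\infty)$ such that $p\mapsto p\log\psi(p)$ is convex and $\lim_{p\to\infty}\psi(p)=\infty$. Orlicz functions: for $\psi\in\Psi$, $N[\psi](u)=\exp\left\{\sup_{p\ge\alpha}\left(p\log|u|-p\log\psi(p)\right)\right\}$ for $|u|\ge e^2$; for $|u|<e^2$ it is defined arbitrarily so that $N[\psi]$ is even, continuous, convex, strictly increasing on $[0,\infty)$, and $N[\psi](u)=0$ iff $u=0$. Put $\psi_d(p)=p^d\psi(p)$ (again in $\Psi$) and $N_d[\psi]=N[\psi_d]$. Orlicz norm on $X$ with Lebesgue measure: $\|f\|_{L(N)}=\inf_{v>0}\left\{v^{-1}\left(1+\int_X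 N(v|f(x)|)\,dx\right)\right\}$, and $L(N)$ is the space of measurable $f$ with finite norm. *)

theory Defs
  imports "HOL-Analysis.Analysis"
begin

definition torus_box :: "(real ^ 'd) set" where
  "torus_box = cbox 0 (\<chi> i. 2 * pi)"

definition char_pairing :: "int ^ 'd \<Rightarrow> real ^ 'd \<Rightarrow> real" where
  "char_pairing n x = (\<Sum>j\<in>UNIV. of_int (n $ j) * x $ j)"

definition max_norm :: "int ^ 'd \<Rightarrow> int" where
  "max_norm n = Max (range (\<lambda>j. \<bar>n $ j\<bar>))"

definition fourier_coeff :: "(real ^ 'd \<Rightarrow> complex) \<Rightarrow> int ^ 'd \<Rightarrow> complex" where
  "fourier_coeff f n =
     (\<integral>x. exp (\<i> * complex_of_real (char_pairing n x)) * f x \<partial>lebesgue_on torus_box)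
       / complex_of_real ((2 * pi) ^ CARD('d))"

definition fourier_sum :: "nat \<Rightarrow> (real ^ 'd \<Rightarrow> complex) \<Rightarrow> real ^ 'd \<Rightarrow> complex" where
  "fourier_sum M f x =
     (\<Sum>n | max_norm n \<le> int M.
        fourier_coeff f n * exp (- \<i> * complex_of_real (char_pairing n x)))"

text \<open>The index set of \<^const>\<open>fourier_sum\<close> is finite, so the sum is not degenerate.\<close>

lemma finite_max_norm_le: "finite {n :: int ^ 'd. max_norm n \<le> k}"
proof -
  have "n \<in> vec_lambda ` (UNIV \<rightarrow>\<^sub>E {-k..k})" if "max_norm n \<le> k" for n :: "int ^ 'd"
  proof -
    have "\<bar>n $ i\<bar> \<le> k" for i
      using that by (simp add: max_norm_def)
    then have "n $ i \<in> {-k..k}" for i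
      using abs_le_iff[of "n $ i" k] by (simp add: minus_le_iff)
    then have "vec_nth n \<in> (UNIV \<rightarrow>\<^sub>E {-k..k})"
      by (auto simp only: PiE_UNIV_domain Pi_iff)
    then show ?thesis
      by (rule rev_image_eqI) simp
  qed
  then have "{n :: int ^ 'd. max_norm n \<le> k} \<subseteq> vec_lambda ` (UNIV \<rightarrow>\<^sub>E {-k..k})"
    by blast
  then show ?thesis
    by (rule finite_subset) (intro finite_imageI finite_PiE; simp)
qed

text \<open>Functions on \<open>[\<alpha>,\<infinity>)\<close> are represented by total functions on the reals; values
  below \<open>\<alpha>\<close> are never used.\<close>

definition Psi_class :: "real \<Rightarrow> (real \<Rightarrow> real) set" where
  "Psi_class \<alpha> = {\<psi>.
     continuous_on {\<alpha>..} \<psi> \<and>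
     (\<forall>p\<ge>\<alpha>. \<psi> p > 0) \<and>
     strict_mono_on {\<alpha>..} \<psi> \<and>
     convex_on {\<alpha>..} (\<lambda>p. p * ln (\<psi> p)) \<and>
     filterlim \<psi> at_top at_top}"

definition psi_pow :: "nat \<Rightarrow> (real \<Rightarrow> real) \<Rightarrow> real \<Rightarrow> real" where
  "psi_pow d \<psi> p = p ^ d * \<psi> p"

text \<open>Since the values on \<open>(-e\<^sup>2, e\<^sup>2)\<close> are arbitrary up to the listed conditions, the Orlicz
  function of \<open>\<psi>\<close> is captured by a predicate: \<open>N\<close> is an admissible version of it.\<close>

definition is_orlicz_fun :: "real \<Rightarrow> (real \<Rightarrow> real) \<Rightarrow> (real \<Rightarrow> real) \<Rightarrow> bool" where
  "is_orlicz_fun \<alpha> \<psi> N \<longleftrightarrow>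
     (\<forall>u. \<bar>u\<bar> \<ge> exp 2 \<longrightarrow> N u = exp (SUP p\<in>{\<alpha>..}. p * ln \<bar>u\<bar> - p * ln (\<psi> p))) \<and>
     (\<forall>u. N (- u) = N u) \<and>
     continuous_on UNIV N \<and>
     convex_on UNIV N \<and>
     strict_mono_on {0..} N \<and>
     (\<forall>u. N u = 0 \<longleftrightarrow> u = 0)"

text \<open>The supremum above is finite, so the real-valued \<^const>\<open>Sup\<close> is meaningful.\<close>

lemma Psi_class_bdd_above:
  assumes "\<alpha> \<ge> 1" "\<psi> \<in> Psi_class \<alpha>" "\<bar>u\<bar> > 0"
  shows "bdd_above ((\<lambda>p. p * ln \<bar>u\<bar> - p * ln (\<psi> p)) ` {\<alpha>..})"
proof -
  have pos: "\<psi> p > 0" if "p \<ge> \<alpha>" for p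
    using assms(2) that by (simp add: Psi_class_def)
  have mono: "\<psi> \<alpha> \<le> \<psi> p" if "p \<ge> \<alpha>" for p
    using assms(2) that strict_mono_on_leD[of "{\<alpha>..}" \<psi> \<alpha> p] by (auto simp: Psi_class_def)
  have "\<forall>\<^sub>F p in at_top. \<psi> p \<ge> \<bar>u\<bar>"
    using assms(2) by (simp add: Psi_class_def filterlim_at_top)
  then obtain K where K: "\<And>p. p \<ge> K \<Longrightarrow> \<psi> p \<ge> \<bar>u\<bar>"
    by (auto simp: eventually_at_top_linorder)
  define B where "B = \<bar>K\<bar> * \<bar>ln \<bar>u\<bar> - ln (\<psi> \<alpha>)\<bar>"
  have "p * ln \<bar>u\<bar> - p * ln (\<psi> p) \<le> B" if p: "p \<ge> \<alpha>" for p
  proof (cases "p \<ge> K")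
    case True
    have "ln \<bar>u\<bar> \<le> ln (\<psi> p)" using K[OF True] assms(3) by simp
    then have "p * ln \<bar>u\<bar> \<le> p * ln (\<psi> p)" using assms(1) p by (intro mult_left_mono) auto
    moreover have "B \<ge> 0" by (simp add: B_def)
    ultimately show ?thesis by linarith
  next
    case False
    have "ln (\<psi> \<alpha>) \<le> ln (\<psi> p)" using mono[OF p] pos[of \<alpha>] by simp
    then have "p * (ln \<bar>u\<bar> - ln (\<psi> p)) \<le> p * \<bar>ln \<bar>u\<bar> - ln (\<psi> \<alpha>)\<bar>"
      using assms(1) p by (intro mult_left_mono) auto
    also have "\<dots> \<le> B" unfolding B_def using False by (intro mult_right_mono) auto
    finally show ?thesis by (simp add: right_diff_distrib)
  qed
  then show ?thesis by (auto intro!: bdd_aboveI2)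
qed

definition orlicz_norm ::
    "'a measure \<Rightarrow> (real \<Rightarrow> real) \<Rightarrow> ('a \<Rightarrow> 'b::real_normed_vector) \<Rightarrow> ennreal" where
  "orlicz_norm \<mu> N f =
     (INF v\<in>{0<..}. ennreal (1 / v) * (1 + (\<integral>\<^sup>+ x. ennreal (N (v * norm (f x))) \<partial>\<mu>)))"

definition orlicz_space ::
    "'a measure \<Rightarrow> (real \<Rightarrow> real) \<Rightarrow> ('a \<Rightarrow> 'b::real_normed_vector) set" where
  "orlicz_space \<mu> N = {f \<in> borel_measurable \<mu>. orlicz_norm \<mu> N f < \<infinity>}"

end

theory Submission
  imports Defs
begin

text \<open>
  On trigonometric polynomials, Cotlar's identity bounds the Hilbert transform in one coordinate on
  \<open>L\<^sup>p\<close> by \<open>p - 1\<close> for \<open>p = 2, 4, 8, \<dots>\<close>, and \<open>s\<^sub>M\<close> is a product over the coordinates of half-differences of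
  two modulated Hilbert transforms, so its norm on \<open>L\<^sup>p\<close> is at most \<open>p ^ d\<close>. Averaging against a positive
  kernel of Fejer type transfers this to all functions in \<open>L\<^sup>p\<close>.

  Moment bounds alone do not determine the exponential Orlicz norm when \<open>\<psi>\<close> grows very fast, so the last
  step is a Marcinkiewicz interpolation with an exponent depending on the level: for \<open>u = 2 ^ k\<close> let \<open>p\<close>
  almost attain the supremum defining \<open>N\<^sub>d (2 u)\<close>, cut \<open>f\<close> at a height comparable to \<open>u / p ^ d\<close>, and use
  \<open>L\<^sup>2\<close> above the cut and \<open>L\<^sup>q\<close> with a power of two \<open>q \<in> [p + 1, 4 p]\<close> below it. Against \<open>N (\<bar>f\<bar>)\<close>, the
  contribution of the level \<open>u\<close> is \<open>O (min x (1 / x))\<close> with \<open>x\<close> comparable to \<open>u / \<bar>f\<bar>\<close>, which is summable over \<open>k\<close>.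
\<close>

section \<open>Trigonometric polynomials over an orthogonal system of characters\<close>

text \<open>In the factorisation of \<open>c ^ n - s ^ n\<close> by \<open>c - s\<close>, each
  summand is at least or at most \<open>s ^ (n - 1)\<close> according to the sign of
  \<open>c - s\<close>. This tangent line gives both the convexity of powers and Jensen's inequality
  for the Fejer kernel.\<close>

lemma power_ge_tangent:
  fixes c s :: real
  assumes "c \<ge> 0" "s \<ge> 0"
  shows "c ^ n \<ge> s ^ n + of_nat n * s ^ (n - 1) * (c - s)"
proof -
  have split: "s ^ (n - 1) = s ^ (n - Suc i) * s ^ i" if "i < n" for i
    using that by (simp add: power_add [symmetric])
  have "(c - s) * (\<Sum>i<n. s ^ (n - Suc i) * c ^ i) \<ge> (c - s) * (\<Sum>i<n. s ^ (n - 1))"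
  proof (cases "c \<ge> s")
    case True
    then have "s ^ (n - 1) \<le> s ^ (n - Suc i) * c ^ i" if "i < n" for i
      using assms split[OF that] by (simp add: mult_left_mono power_mono)
    then show ?thesis using True by (intro mult_left_mono sum_mono) auto
  next
    case False
    then have "s ^ (n - Suc i) * c ^ i \<le> s ^ (n - 1)" if "i < n" for i
      using assms split[OF that] by (simp add: mult_left_mono power_mono)
    then show ?thesis using False by (intro mult_left_mono_neg sum_mono) auto
  qed
  then show ?thesis
    using power_diff_sumr2[of c n s] by (simp add: algebra_simps)
qed

text \<open>The two tangent bounds are taken at the combined point \<open>s\<close>, where their
  weighted linear terms cancel.\<close>

lemma convex_combination_power:
  fixes a b t :: real
  assumes "a \<ge> 0" "b \<ge> 0" "0 \<le> t" "t \<le> 1"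
  shows "(t * a + (1 - t) * b) ^ n \<le> t * a ^ n + (1 - t) * b ^ n"
proof -
  define s where "s = t * a + (1 - t) * b"
  have s: "s \<ge> 0" using assms by (simp add: s_def)
  have "t * a ^ n + (1 - t) * b ^ n \<ge> t * (s ^ n + of_nat n * s ^ (n - 1) * (a - s))
      + (1 - t) * (s ^ n + of_nat n * s ^ (n - 1) * (b - s))"
    using assms s by (intro add_mono mult_left_mono power_ge_tangent) auto
  also have "t * (s ^ n + of_nat n * s ^ (n - 1) * (a - s))
      + (1 - t) * (s ^ n + of_nat n * s ^ (n - 1) * (b - s)) = s ^ n"
    by (simp add: s_def algebra_simps)
  finally show ?thesis by (simp add: s_def)
qed

lemma borel_measurable_cnj [measurable (raw)]:
  "f \<in> borel_measurable N \<Longrightarrow> (\<lambda>x. cnj (f x)) \<in> borel_measurable N"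
  by (rule borel_measurable_continuous_on[of cnj]) (intro continuous_intros)

section \<open>Characters and trigonometric polynomials\<close>

text \<open>The group \<open>'g\<close> of frequencies carries the structure: \<open>e\<close> turns
  addition of frequencies into multiplication of unimodular functions, and \<open>integral_e\<close>
  is orthogonality, because \<open>e m\<close> times the conjugate of \<open>e n\<close> is
  \<open>e (m - n)\<close>.\<close>

locale character_system = finite_measure M for M :: "'a measure" +
  fixes e :: "'g::ab_group_add \<Rightarrow> 'a \<Rightarrow> complex"
  assumes e_measurable [measurable]: "e n \<in> borel_measurable M"
    and norm_e: "norm (e n x) = 1"
    and e_add: "e (m + n) x = e m x * e n x"
    and integral_e: "n \<noteq> 0 \<Longrightarrow> (\<integral>x. e n x \<partial>M) = 0"
begin

lemma e_0: "e 0 x = 1"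
proof -
  have "e 0 x * e 0 x = e 0 x * 1" using e_add[of 0 0 x] by simp
  moreover have "e 0 x \<noteq> 0" using norm_e[of 0 x] by auto
  ultimately show ?thesis by (simp only: mult_cancel_left) auto
qed

lemma e_uminus: "e (- n) x = cnj (e n x)"
proof -
  have "e n x * e (- n) x = 1" using e_add[of n "- n" x] by (simp add: e_0)
  moreover have "e n x * cnj (e n x) = 1" by (simp add: complex_norm_square [symmetric] norm_e)
  moreover have "e n x \<noteq> 0" using norm_e[of n x] by auto
  ultimately show ?thesis by (metis mult_cancel_left)
qed

lemma e_diff: "e (m - n) x = e m x * cnj (e n x)"
  using e_add[of m "- n" x] by (simp add: e_uminus)

text \<open>The set \<open>A\<close> confines the spectrum. Keeping it as a parameter reduces
  Cotlar's argument to arithmetic of frequencies: products add them and conjugation negates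
  them.\<close>

definition trig :: "'g set \<Rightarrow> ('a \<Rightarrow> complex) set" where
  "trig A = {\<lambda>x. \<Sum>n\<in>S. c n * e n x | S c. finite S \<and> S \<subseteq> A}"

lemma trigI: "finite S \<Longrightarrow> S \<subseteq> A \<Longrightarrow> (\<lambda>x. \<Sum>n\<in>S. c n * e n x) \<in> trig A"
  by (auto simp: trig_def)

lemma trigE:
  assumes "f \<in> trig A"
  obtains S c where "finite S" "S \<subseteq> A" "f = (\<lambda>x. \<Sum>n\<in>S. c n * e n x)"
  using assms by (auto simp: trig_def)

lemma trig_monomial: "n \<in> A \<Longrightarrow> (\<lambda>x. a * e n x) \<in> trig A"
  using trigI[of "{n}" A "\<lambda>_. a"] by simp

lemma trig_zero: "(\<lambda>x. 0) \<in> trig A"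
  using trigI[of "{}" A] by simp

lemma trig_add:
  assumes "f \<in> trig A" "g \<in> trig A"
  shows "(\<lambda>x. f x + g x) \<in> trig A"
proof -
  obtain S c where f: "finite S" "S \<subseteq> A" "f = (\<lambda>x. \<Sum>n\<in>S. c n * e n x)"
    using assms(1) by (rule trigE)
  obtain T d where g: "finite T" "T \<subseteq> A" "g = (\<lambda>x. \<Sum>n\<in>T. d n * e n x)"
    using assms(2) by (rule trigE)
  have "(\<lambda>x. f x + g x) = (\<lambda>x. \<Sum>n\<in>S \<union> T. ((if n \<in> S then c n else 0) + (if n \<in> T then d n else 0)) * e n x)"
  proof
    fix x
    have "f x = (\<Sum>n\<in>S \<union> T. (if n \<in> S then c n else 0) * e n x)"
      using f g by (auto intro!: sum.mono_neutral_cong_left)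
    moreover have "g x = (\<Sum>n\<in>S \<union> T. (if n \<in> T then d n else 0) * e n x)"
      using f g by (auto intro!: sum.mono_neutral_cong_left)
    ultimately show "f x + g x = (\<Sum>n\<in>S \<union> T. ((if n \<in> S then c n else 0) + (if n \<in> T then d n else 0)) * e n x)"
      by (simp add: sum.distrib distrib_right)
  qed
  then show ?thesis using f g by (simp add: trigI)
qed

lemma trig_sum: "(\<And>i. i \<in> I \<Longrightarrow> f i \<in> trig A) \<Longrightarrow> (\<lambda>x. \<Sum>i\<in>I. f i x) \<in> trig A"
  by (induction I rule: infinite_finite_induct) (auto simp: trig_zero trig_add)

lemma trig_mult:
  assumes "f \<in> trig A" "g \<in> trig B" and AB: "\<And>m n. m \<in> A \<Longrightarrow> n \<in> B \<Longrightarrow> m + n \<in> D"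
  shows "(\<lambda>x. f x * g x) \<in> trig D"
proof -
  obtain S c where f: "finite S" "S \<subseteq> A" "f = (\<lambda>x. \<Sum>n\<in>S. c n * e n x)"
    using assms(1) by (rule trigE)
  obtain T d where g: "finite T" "T \<subseteq> B" "g = (\<lambda>x. \<Sum>n\<in>T. d n * e n x)"
    using assms(2) by (rule trigE)
  have "(\<lambda>x. f x * g x) = (\<lambda>x. \<Sum>m\<in>S. \<Sum>n\<in>T. (c m * d n) * e (m + n) x)"
    by (simp add: f(3) g(3) sum_product e_add algebra_simps)
  also have "\<dots> \<in> trig D"
    using f g by (intro trig_sum trig_monomial AB) auto
  finally show ?thesis .
qed

lemma trig_cnj:
  assumes "f \<in> trig A" "\<And>n. n \<in> A \<Longrightarrow> - n \<in> B"
  shows "(\<lambda>x. cnj (f x)) \<in> trig B"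
proof -
  obtain S c where f: "finite S" "S \<subseteq> A" "f = (\<lambda>x. \<Sum>n\<in>S. c n * e n x)"
    using assms(1) by (rule trigE)
  have "(\<lambda>x. cnj (f x)) = (\<lambda>x. \<Sum>n\<in>S. cnj (c n) * e (- n) x)"
    by (simp add: f(3) e_uminus)
  also have "\<dots> \<in> trig B"
    using f assms(2) by (intro trig_sum trig_monomial) auto
  finally show ?thesis .
qed

lemma trig_cmult: "f \<in> trig A \<Longrightarrow> (\<lambda>x. a * f x) \<in> trig A"
  by (erule trigE) (auto simp: sum_distrib_left mult.assoc [symmetric] intro!: trigI)

lemma trig_measurable: "f \<in> trig A \<Longrightarrow> f \<in> borel_measurable M"
  by (erule trigE) simp

lemma trig_bounded:
  assumes "f \<in> trig A"
  obtains B where "\<And>x. norm (f x) \<le> B"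
proof -
  obtain S c where f: "finite S" "S \<subseteq> A" "f = (\<lambda>x. \<Sum>n\<in>S. c n * e n x)"
    using assms(1) by (rule trigE)
  have "norm (f x) \<le> (\<Sum>n\<in>S. norm (c n))" for x
    unfolding f by (rule order_trans[OF norm_sum]) (simp add: norm_mult norm_e)
  then show ?thesis by (rule that)
qed

lemma trig_integrable: "f \<in> trig A \<Longrightarrow> integrable M f"
  by (metis integrable_const_bound AE_I2 trig_bounded trig_measurable)

lemma trig_integrable_power:
  assumes "f \<in> trig A"
  shows "integrable M (\<lambda>x. norm (f x) ^ p)"
proof -
  obtain B where "\<And>x. norm (f x) \<le> B" using trig_bounded[OF assms] by blast
  then have "norm (norm (f x) ^ p) \<le> B ^ p" for x
    by (simp add: power_mono)
  moreover have "f \<in> borel_measurable M" using assms by (rule trig_measurable)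
  ultimately show ?thesis
    by (intro integrable_const_bound[of _ "B ^ p"]) auto
qed

lemma trig_integral_zero:
  assumes "f \<in> trig A" "0 \<notin> A"
  shows "(\<integral>x. f x \<partial>M) = 0"
proof -
  obtain S c where f: "finite S" "S \<subseteq> A" "f = (\<lambda>x. \<Sum>n\<in>S. c n * e n x)"
    using assms(1) by (rule trigE)
  have "integrable M (e n)" for n
    using trig_integrable[OF trig_monomial[of n UNIV 1]] by simp
  then have "(\<integral>x. f x \<partial>M) = (\<Sum>n\<in>S. c n * (\<integral>x. e n x \<partial>M))"
    by (simp add: f(3))
  also have "\<dots> = 0"
    using f(2) assms(2) by (intro sum.neutral) (auto intro!: integral_e)
  finally show ?thesis .
qed

text \<open>The argument is Cotlar's: with \<open>h = F - G\<close> and \<open>f = F + G\<close> one has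
  \<open>h\<^sup>2 = 2 (F\<^sup>2 + G\<^sup>2) - f\<^sup>2\<close>, and \<open>F\<^sup>2\<close>, \<open>- G\<^sup>2\<close> is again an admissible pair, with sum \<open>f h\<close>.\<close>

lemma hilbert_transform_bound:
  assumes "F \<in> trig A" "G \<in> trig B"
    and A: "\<And>m n. m \<in> A \<Longrightarrow> n \<in> A \<Longrightarrow> m + n \<in> A"
    and B: "\<And>m n. m \<in> B \<Longrightarrow> n \<in> B \<Longrightarrow> m + n \<in> B"
    and AB: "A \<inter> B = {}"
  shows "(\<integral>x. norm (F x - G x) ^ (2 ^ Suc k) \<partial>M)
    \<le> (2 ^ Suc k - 1) ^ (2 ^ Suc k) * (\<integral>x. norm (F x + G x) ^ (2 ^ Suc k) \<partial>M)"
  using assms(1,2)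
proof (induction k arbitrary: F G)
  case 0
  \<comment> \<open>The squared moduli of \<open>F - G\<close> and \<open>F + G\<close> differ by
    four times the real part of \<open>P\<close>. The frequencies of \<open>P\<close> are
    differences of elements of \<open>A\<close> and \<open>B\<close>, nonzero by disjointness, so
    \<open>P\<close> has integral zero.\<close>
  define P where "P x = F x * cnj (G x)" for x
  have P: "P \<in> trig (- {0})"
    unfolding P_def using AB
    by (intro trig_mult[OF 0(1) trig_cnj[OF 0(2), of "uminus ` B"]]) (auto simp: disjoint_iff)
  have "(\<integral>x. norm (F x - G x) ^ 2 \<partial>M) = (\<integral>x. norm (F x + G x) ^ 2 - 4 * Re (P x) \<partial>M)"
    by (intro Bochner_Integration.integral_cong refl)
       (simp add: P_def cmod_power2, simp add: power2_eq_square algebra_simps)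
  also have "\<dots> = (\<integral>x. norm (F x + G x) ^ 2 \<partial>M) - 4 * Re (\<integral>x. P x \<partial>M)"
  proof -
    have "F \<in> trig UNIV" "G \<in> trig UNIV" using 0 by (auto simp: trig_def)
    then have "integrable M (\<lambda>x. norm (F x + G x) ^ 2)"
      by (intro trig_integrable_power trig_add)
    moreover have "integrable M P" using P by (rule trig_integrable)
    ultimately show ?thesis by simp
  qed
  also have "(\<integral>x. P x \<partial>M) = 0" by (rule trig_integral_zero[OF P]) simp
  finally show ?case by simp
next
  case (Suc k)
  \<comment> \<open>At exponent \<open>p\<close> the induction hypothesis has the constant
    \<open>a = p - 1\<close>; at exponent \<open>2 * p\<close> the constant to be reached is
    \<open>b = 2 * p - 1\<close>.\<close>
  define p :: nat where "p = 2 ^ Suc k"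
  define a :: real where "a = 2 ^ Suc k - 1"
  define b :: real where "b = 2 * a + 1"
  have "(2::real) \<le> 2 ^ Suc k" by simp
  then have a: "a \<ge> 1" unfolding a_def by linarith
  then have b: "b \<ge> 1" unfolding b_def by simp
  define f where "f x = F x + G x" for x
  define h where "h x = F x - G x" for x
  define w where "w x = F x * F x + G x * G x" for x
  have FG: "F \<in> trig UNIV" "G \<in> trig UNIV" using Suc.prems by (auto simp: trig_def)
  have f: "f \<in> trig UNIV" unfolding f_def by (intro trig_add FG)
  have h: "h \<in> trig UNIV"
    unfolding h_def using trig_add[OF FG(1) trig_cmult[OF FG(2), of "-1"]] by simp
  have w: "w \<in> trig UNIV" unfolding w_def by (intro trig_add trig_mult[OF FG(1,1)] trig_mult[OF FG(2,2)]) auto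
  have fh: "(\<lambda>x. f x * h x) \<in> trig UNIV" by (intro trig_mult[OF f h]) auto
  note int = trig_integrable_power[OF f] trig_integrable_power[OF h] trig_integrable_power[OF w]
    trig_integrable_power[OF fh]
  \<comment> \<open>Since \<open>b = 2 * a + 1\<close>, this weight turns
    \<open>2 * norm (w x) + norm (f x) ^ 2\<close> into \<open>b\<close> times a convex combination
    of \<open>norm (w x) / a\<close> and \<open>norm (f x) ^ 2\<close>.\<close>
  define t where "t = 2 * a / b"
  have t: "0 \<le> t" "t \<le> 1" using a by (auto simp: t_def b_def)
  define X where "X = (\<integral>x. norm (h x) ^ (2 * p) \<partial>M)"
  define Y where "Y = (\<integral>x. norm (f x) ^ (2 * p) \<partial>M)"
  have IH: "(\<integral>x. norm (w x) ^ p \<partial>M) \<le> a ^ p * (\<integral>x. norm (f x * h x) ^ p \<partial>M)"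
  proof -
    have "(\<lambda>x. F x * F x) \<in> trig A" by (rule trig_mult[OF Suc.prems(1,1) A])
    moreover have "(\<lambda>x. - 1 * (G x * G x)) \<in> trig B"
      by (intro trig_cmult trig_mult[OF Suc.prems(2,2) B])
    ultimately have "(\<integral>x. norm (F x * F x - - 1 * (G x * G x)) ^ (2 ^ Suc k) \<partial>M)
      \<le> (2 ^ Suc k - 1) ^ (2 ^ Suc k) * (\<integral>x. norm (F x * F x + - 1 * (G x * G x)) ^ (2 ^ Suc k) \<partial>M)"
      by (rule Suc.IH)
    moreover have "F x * F x + - 1 * (G x * G x) = f x * h x" for x
      by (simp add: f_def h_def algebra_simps)
    ultimately show ?thesis by (simp add: w_def p_def a_def)
  qed
  have "X \<le> (\<integral>x. b ^ p * (t / a ^ p * norm (w x) ^ p + (1 - t) * norm (f x) ^ (2 * p)) \<partial>M)"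
    unfolding X_def
  proof (rule integral_mono)
    fix x
    have "h x * h x = 2 * w x - f x * f x"
      by (simp add: f_def h_def w_def algebra_simps)
    then have "norm (h x) ^ 2 \<le> 2 * norm (w x) + norm (f x) ^ 2"
      by (metis norm_mult norm_numeral norm_triangle_ineq4 power2_eq_square)
    then have "(norm (h x) ^ 2) ^ p \<le> (2 * norm (w x) + norm (f x) ^ 2) ^ p"
      by (intro power_mono) auto
    also have "2 * norm (w x) + norm (f x) ^ 2 = b * (t * (norm (w x) / a) + (1 - t) * norm (f x) ^ 2)"
    proof -
      have bt: "b * t = 2 * a" "b * (1 - t) = 1"
        using b by (simp_all add: t_def b_def right_diff_distrib)
      have "b * (t * (norm (w x) / a) + (1 - t) * norm (f x) ^ 2)
        = (b * t) * (norm (w x) / a) + (b * (1 - t)) * norm (f x) ^ 2"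
        by (simp add: algebra_simps)
      then show ?thesis unfolding bt using a by simp
    qed
    also have "\<dots> ^ p \<le> b ^ p * (t * (norm (w x) / a) ^ p + (1 - t) * (norm (f x) ^ 2) ^ p)"
      unfolding power_mult_distrib using a b t
      by (intro mult_left_mono convex_combination_power) auto
    finally show "norm (h x) ^ (2 * p) \<le> b ^ p * (t / a ^ p * norm (w x) ^ p + (1 - t) * norm (f x) ^ (2 * p))"
      by (simp add: power_mult power_divide)
  qed (use int in auto)
  also have "\<dots> = b ^ p * (t * ((\<integral>x. norm (w x) ^ p \<partial>M) / a ^ p) + (1 - t) * Y)"
    using int by (simp add: Y_def)
  also have "\<dots> \<le> b ^ p * (t * ((b ^ p * Y + X / b ^ p) / 2) + (1 - t) * Y)"
  proof -
    have "(\<integral>x. norm (w x) ^ p \<partial>M) / a ^ p \<le> (\<integral>x. norm (f x * h x) ^ p \<partial>M)"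
      using IH a by (simp add: field_simps)
    \<comment> \<open>Young's inequality, weighted so that after multiplication by
      \<open>b ^ p\<close> the integral \<open>X\<close> returns with a coefficient
      \<open>t / 2 < 1\<close> and can be absorbed on the left.\<close>
    also have "\<dots> \<le> (\<integral>x. (b ^ p * norm (f x) ^ (2 * p) + norm (h x) ^ (2 * p) / b ^ p) / 2 \<partial>M)"
    proof (rule integral_mono)
      fix x
      define u where "u = norm (f x) ^ p"
      define v where "v = norm (h x) ^ p"
      have "0 \<le> (b ^ p * u - v)\<^sup>2 / b ^ p" using b by simp
      also have "\<dots> = b ^ p * u\<^sup>2 + v\<^sup>2 / b ^ p - 2 * (u * v)"
        using b by (simp add: field_simps power2_eq_square)
      finally show "norm (f x * h x) ^ p \<le> (b ^ p * norm (f x) ^ (2 * p) + norm (h x) ^ (2 * p) / b ^ p) / 2"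
        by (simp add: u_def v_def norm_mult power_mult_distrib power_mult [symmetric] mult.commute)
    qed (use int in auto)
    also have "\<dots> = (b ^ p * Y + X / b ^ p) / 2"
      using int by (simp add: X_def Y_def)
    finally show ?thesis
      using t b by (intro mult_left_mono add_mono) auto
  qed
  also have "\<dots> = t / 2 * X + Y * (t / 2 * b ^ (2 * p) + (1 - t) * b ^ p)"
    using b by (simp add: field_simps power_mult power2_eq_square)
  also have "\<dots> \<le> t / 2 * X + Y * ((1 - t / 2) * b ^ (2 * p))"
  proof -
    have "b ^ p \<le> b ^ (2 * p)" using b by (intro power_increasing) auto
    then have "(1 - t) * b ^ p \<le> (1 - t) * b ^ (2 * p)" using t by (intro mult_left_mono) auto
    then have "t / 2 * b ^ (2 * p) + (1 - t) * b ^ p \<le> (1 - t / 2) * b ^ (2 * p)"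
      by (simp add: algebra_simps)
    moreover have "Y \<ge> 0" by (simp add: Y_def)
    ultimately show ?thesis by (intro add_left_mono mult_left_mono) auto
  qed
  finally have "(1 - t / 2) * X \<le> (1 - t / 2) * (b ^ (2 * p) * Y)"
    by (simp add: algebra_simps)
  moreover have "1 - t / 2 > 0" using t by linarith
  ultimately have "X \<le> b ^ (2 * p) * Y" by (simp only: mult_le_cancel_left_pos)
  moreover have "b = 2 ^ Suc (Suc k) - 1" by (simp add: b_def a_def)
  moreover have "2 * p = 2 ^ Suc (Suc k)" by (simp add: p_def)
  ultimately show ?case by (simp only: X_def Y_def f_def h_def)
qed

section \<open>Half spaces, strips and cubes of frequencies\<close>

text \<open>Multiplication by the unimodular \<open>e s\<close> with \<open>\<phi> s = - a\<close>
  moves the threshold \<open>a\<close> to 0 without changing any norm. The half spaces where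
  \<open>\<phi>\<close> is nonnegative and where it is negative are disjoint and closed under
  addition, so \<open>hilbert_transform_bound\<close> applies.\<close>

lemma half_space_multiplier_bound:
  fixes \<phi> :: "'g \<Rightarrow> int"
  assumes \<phi>: "\<And>m n. \<phi> (m + n) = \<phi> m + \<phi> n" and "surj \<phi>" and S: "finite S"
  shows "(\<integral>x. norm (\<Sum>n\<in>S. (if \<phi> n \<ge> a then 1 else - 1) * c n * e n x) ^ (2 ^ Suc k) \<partial>M)
    \<le> (2 ^ Suc k - 1) ^ (2 ^ Suc k) * (\<integral>x. norm (\<Sum>n\<in>S. c n * e n x) ^ (2 ^ Suc k) \<partial>M)"
proof -
  obtain s where s: "\<phi> s = - a" using \<open>surj \<phi>\<close> by (metis surjD)
  define F where "F x = (\<Sum>n\<in>{n\<in>S. \<phi> n \<ge> a}. c n * e (n + s) x)" for x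
  define G where "G x = (\<Sum>n\<in>{n\<in>S. \<phi> n < a}. c n * e (n + s) x)" for x
  have split: "(\<Sum>n\<in>S. h n) = (\<Sum>n\<in>{n\<in>S. \<phi> n \<ge> a}. h n) + (\<Sum>n\<in>{n\<in>S. \<phi> n < a}. h n)"
    for h :: "'g \<Rightarrow> complex"
    using S by (subst sum.union_disjoint [symmetric]) (auto intro!: sum.cong)
  have F: "F \<in> trig {n. \<phi> n \<ge> 0}"
    unfolding F_def by (intro trig_sum trig_monomial) (auto simp: \<phi> s)
  have G: "G \<in> trig {n. \<phi> n < 0}"
    unfolding G_def by (intro trig_sum trig_monomial) (auto simp: \<phi> s)
  have diff: "F x - G x = e s x * (\<Sum>n\<in>S. (if \<phi> n \<ge> a then 1 else - 1) * c n * e n x)" for x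
    by (subst split) (simp add: F_def G_def e_add sum_distrib_left right_diff_distrib mult_ac sum_negf)
  have sum: "F x + G x = e s x * (\<Sum>n\<in>S. c n * e n x)" for x
    by (subst split) (simp add: F_def G_def e_add sum_distrib_left distrib_left mult_ac)
  have "(\<integral>x. norm (F x - G x) ^ (2 ^ Suc k) \<partial>M)
    \<le> (2 ^ Suc k - 1) ^ (2 ^ Suc k) * (\<integral>x. norm (F x + G x) ^ (2 ^ Suc k) \<partial>M)"
    by (rule hilbert_transform_bound[OF F G]) (auto simp: \<phi>)
  then show ?thesis by (simp only: diff sum norm_mult norm_e mult_1_left)
qed

text \<open>Twice the indicator of the strip is the difference of the sign multipliers with
  thresholds \<open>- m\<close> and \<open>m + 1\<close>. Halving that difference and using
  convexity of the power preserves the half-space constant.\<close>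

lemma strip_multiplier_bound:
  fixes \<phi> :: "'g \<Rightarrow> int" and m :: int
  assumes \<phi>: "\<And>m n. \<phi> (m + n) = \<phi> m + \<phi> n" "surj \<phi>" and S: "finite S" and "m \<ge> 0"
  shows "(\<integral>x. norm (\<Sum>n\<in>{n\<in>S. \<bar>\<phi> n\<bar> \<le> m}. c n * e n x) ^ (2 ^ Suc k) \<partial>M)
    \<le> (2 ^ Suc k - 1) ^ (2 ^ Suc k) * (\<integral>x. norm (\<Sum>n\<in>S. c n * e n x) ^ (2 ^ Suc k) \<partial>M)"
proof -
  define p :: nat where "p = 2 ^ Suc k"
  define H where "H a x = (\<Sum>n\<in>S. (if \<phi> n \<ge> a then 1 else - 1) * c n * e n x)" for a x
  have H: "H a \<in> trig UNIV" for a unfolding H_def using S by (intro trigI) auto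
  have "(\<Sum>n\<in>{n\<in>S. \<bar>\<phi> n\<bar> \<le> m}. c n * e n x) = (\<Sum>n\<in>S. (if \<bar>\<phi> n\<bar> \<le> m then c n * e n x else 0))" for x
    using S by (simp add: sum.inter_filter)
  moreover have "2 * (if \<bar>\<phi> n\<bar> \<le> m then c n * e n x else 0) =
      (if \<phi> n \<ge> - m then 1 else - 1) * c n * e n x - (if \<phi> n \<ge> m + 1 then 1 else - 1) * c n * e n x" for n x
    using \<open>m \<ge> 0\<close> by auto
  ultimately have *: "2 * (\<Sum>n\<in>{n\<in>S. \<bar>\<phi> n\<bar> \<le> m}. c n * e n x) = H (- m) x - H (m + 1) x" for x
    by (simp only: H_def sum_distrib_left sum_subtractf [symmetric])
  have "(\<integral>x. norm (\<Sum>n\<in>{n\<in>S. \<bar>\<phi> n\<bar> \<le> m}. c n * e n x) ^ p \<partial>M)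
    \<le> (\<integral>x. (norm (H (- m) x) ^ p + norm (H (m + 1) x) ^ p) / 2 \<partial>M)"
  proof (rule integral_mono)
    fix x
    have "norm (2 * (\<Sum>n\<in>{n\<in>S. \<bar>\<phi> n\<bar> \<le> m}. c n * e n x)) \<le> norm (H (- m) x) + norm (H (m + 1) x)"
      unfolding * by (rule norm_triangle_ineq4)
    then have "norm (\<Sum>n\<in>{n\<in>S. \<bar>\<phi> n\<bar> \<le> m}. c n * e n x) ^ p
      \<le> (1 / 2 * norm (H (- m) x) + (1 - 1 / 2) * norm (H (m + 1) x)) ^ p"
      by (intro power_mono) (auto simp: norm_mult)
    also have "\<dots> \<le> 1 / 2 * norm (H (- m) x) ^ p + (1 - 1 / 2) * norm (H (m + 1) x) ^ p"
      by (intro convex_combination_power) auto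
    finally show "norm (\<Sum>n\<in>{n\<in>S. \<bar>\<phi> n\<bar> \<le> m}. c n * e n x) ^ p
      \<le> (norm (H (- m) x) ^ p + norm (H (m + 1) x) ^ p) / 2" by simp
  next
    have "(\<lambda>x. \<Sum>n\<in>{n\<in>S. \<bar>\<phi> n\<bar> \<le> m}. c n * e n x) \<in> trig UNIV"
      using S by (intro trigI) auto
    then show "integrable M (\<lambda>x. norm (\<Sum>n\<in>{n\<in>S. \<bar>\<phi> n\<bar> \<le> m}. c n * e n x) ^ p)"
      by (rule trig_integrable_power)
  qed (use trig_integrable_power[OF H] in auto)
  also have "\<dots> = ((\<integral>x. norm (H (- m) x) ^ p \<partial>M) + (\<integral>x. norm (H (m + 1) x) ^ p \<partial>M)) / 2"
    using trig_integrable_power[OF H] by simp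
  also have "\<dots> \<le> (2 ^ Suc k - 1) ^ p * (\<integral>x. norm (\<Sum>n\<in>S. c n * e n x) ^ p \<partial>M)"
  proof -
    have "(X + Y) / 2 \<le> Z" if "X \<le> Z" "Y \<le> Z" for X Y Z :: real using that by simp
    then show ?thesis unfolding p_def H_def by this (rule half_space_multiplier_bound[OF \<phi> S])+
  qed
  finally show ?thesis by (simp only: p_def)
qed

text \<open>Each further coordinate truncates the already truncated polynomial to one more strip, at
  the price of one more factor.\<close>

lemma cube_multiplier_bound:
  fixes \<phi> :: "'j \<Rightarrow> 'g \<Rightarrow> int" and m :: int
  assumes \<phi>: "\<And>j m n. \<phi> j (m + n) = \<phi> j m + \<phi> j n" "\<And>j. surj (\<phi> j)"
    and S: "finite S" and m: "m \<ge> 0" and J: "finite J"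
  shows "(\<integral>x. norm (\<Sum>n\<in>{n\<in>S. \<forall>j\<in>J. \<bar>\<phi> j n\<bar> \<le> m}. c n * e n x) ^ (2 ^ Suc k) \<partial>M)
    \<le> ((2 ^ Suc k - 1) ^ (2 ^ Suc k)) ^ card J * (\<integral>x. norm (\<Sum>n\<in>S. c n * e n x) ^ (2 ^ Suc k) \<partial>M)"
  using J
proof (induction J rule: finite_induct)
  case (insert i J)
  have "{n\<in>S. \<forall>j\<in>insert i J. \<bar>\<phi> j n\<bar> \<le> m} = {n \<in> {n\<in>S. \<forall>j\<in>J. \<bar>\<phi> j n\<bar> \<le> m}. \<bar>\<phi> i n\<bar> \<le> m}"
    by auto
  then have "(\<integral>x. norm (\<Sum>n\<in>{n\<in>S. \<forall>j\<in>insert i J. \<bar>\<phi> j n\<bar> \<le> m}. c n * e n x) ^ (2 ^ Suc k) \<partial>M)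
    \<le> (2 ^ Suc k - 1) ^ (2 ^ Suc k)
      * (\<integral>x. norm (\<Sum>n\<in>{n\<in>S. \<forall>j\<in>J. \<bar>\<phi> j n\<bar> \<le> m}. c n * e n x) ^ (2 ^ Suc k) \<partial>M)"
    using strip_multiplier_bound[of "\<phi> i" "{n\<in>S. \<forall>j\<in>J. \<bar>\<phi> j n\<bar> \<le> m}" m c k] \<phi> S m by simp
  also have "\<dots> \<le> (2 ^ Suc k - 1) ^ (2 ^ Suc k) * (((2 ^ Suc k - 1) ^ (2 ^ Suc k)) ^ card J
      * (\<integral>x. norm (\<Sum>n\<in>S. c n * e n x) ^ (2 ^ Suc k) \<partial>M))"
    using one_le_power[of "2 :: real" "Suc k"] by (intro mult_left_mono insert.IH zero_le_power) auto
  finally show ?case by (simp only: card_insert_disjoint[OF insert.hyps] power_Suc mult.assoc)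
qed simp

section \<open>Fejer means and transference from polynomials to functions\<close>

definition coeff :: "('a \<Rightarrow> complex) \<Rightarrow> 'g \<Rightarrow> complex" where
  "coeff f n = (\<integral>x. cnj (e n x) * f x \<partial>M) / measure M (space M)"

text \<open>Up to division by the total mass, this is the kernel of the orthogonal projection onto
  the span of the \<open>e k\<close> with \<open>k \<in> B\<close>. Its squared modulus is the
  positive kernel used for averaging.\<close>

definition dirichlet :: "'g set \<Rightarrow> 'a \<Rightarrow> 'a \<Rightarrow> complex" where
  "dirichlet B x y = (\<Sum>k\<in>B. e k x * cnj (e k y))"

lemma dirichlet_sq: "complex_of_real ((norm (dirichlet B x y))\<^sup>2) = (\<Sum>(k, l)\<in>B \<times> B. e (k - l) x * cnj (e (k - l) y))"
  by (simp add: complex_norm_square dirichlet_def sum_product sum.cartesian_product e_diff split_beta mult_ac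
      del: of_real_power)

lemma dirichlet_commute: "norm (dirichlet B x y) = norm (dirichlet B y x)"
proof -
  have "dirichlet B x y = cnj (dirichlet B y x)"
    by (simp add: dirichlet_def mult.commute)
  then show ?thesis by simp
qed

lemma dirichlet_measurable [measurable]: "(\<lambda>(x, y). dirichlet B x y) \<in> borel_measurable (M \<Otimes>\<^sub>M M)"
  unfolding dirichlet_def split_beta by measurable

lemma dirichlet_measurable2 [measurable]: "dirichlet B x \<in> borel_measurable M"
  unfolding dirichlet_def by measurable

lemma dirichlet_bounded:
  assumes "finite B"
  shows "norm (dirichlet B x y) \<le> card B"
proof -
  have "norm (dirichlet B x y) \<le> (\<Sum>k\<in>B. norm (e k x * cnj (e k y)))"
    unfolding dirichlet_def by (rule norm_sum)
  then show ?thesis by (simp add: norm_mult norm_e)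
qed

text \<open>After expansion of the square only the diagonal \<open>k = l\<close> contributes. The
  value is the normalisation that makes the Fejer-type kernel a probability density.\<close>

lemma integral_dirichlet_sq:
  assumes B: "finite B"
  shows "(\<integral>y. (norm (dirichlet B x y))\<^sup>2 \<partial>M) = card B * measure M (space M)"
proof -
  have e0: "e 0 = (\<lambda>x. 1)" by (rule ext) (rule e_0)
  have int: "integrable M (\<lambda>y. cnj (e n y))" for n
    using trig_integrable[OF trig_monomial[of n UNIV 1]] by simp
  have "complex_of_real (\<integral>y. (norm (dirichlet B x y))\<^sup>2 \<partial>M)
    = (\<integral>y. (\<Sum>(k, l)\<in>B \<times> B. e (k - l) x * cnj (e (k - l) y)) \<partial>M)"
    by (simp only: integral_complex_of_real [symmetric] dirichlet_sq)
  also have "\<dots> = (\<Sum>(k, l)\<in>B \<times> B. e (k - l) x * cnj (\<integral>y. e (k - l) y \<partial>M))"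
    using int by (simp add: split_beta)
  also have "\<dots> = (\<Sum>k\<in>B. \<Sum>l\<in>B. if k = l then complex_of_real (measure M (space M)) else 0)"
    unfolding sum.cartesian_product by (intro sum.cong refl) (auto simp: integral_e e0 scaleR_conv_of_real)
  also have "\<dots> = complex_of_real (card B * measure M (space M))"
    using B by simp
  finally show ?thesis by (simp only: of_real_eq_iff)
qed

lemma integrable_if_power_integrable:
  fixes f :: "'a \<Rightarrow> complex"
  assumes f [measurable]: "f \<in> borel_measurable M" and "integrable M (\<lambda>x. norm (f x) ^ p)" "p \<ge> 1"
  shows "integrable M f"
proof (rule Bochner_Integration.integrable_bound)
  show "integrable M (\<lambda>x. 1 + norm (f x) ^ p)" using assms by simp
  show "AE x in M. norm (f x) \<le> norm (1 + norm (f x) ^ p)"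
  proof (rule AE_I2)
    fix x
    have "norm (f x) \<le> 1 + norm (f x) ^ p"
    proof (cases "norm (f x) \<le> 1")
      case True
      then show ?thesis by (simp add: add_increasing2)
    next
      case False
      then have "norm (f x) ^ 1 \<le> norm (f x) ^ p" using assms(3) by (intro power_increasing) auto
      then show ?thesis by simp
    qed
    then show "norm (f x) \<le> norm (1 + norm (f x) ^ p)" by (simp add: abs_if)
  qed
qed fact

text \<open>The left-hand side is the mean of \<open>f\<close> against the Fejer-type kernel
  \<open>\<bar>dirichlet B x y\<bar>\<^sup>2\<close>, a probability density in each variable.\<close>

lemma fejer_mean_bound:
  assumes B: "finite B" "B \<noteq> {}" and V: "measure M (space M) > 0"
    and f [measurable]: "f \<in> borel_measurable M" and fp: "integrable M (\<lambda>x. norm (f x) ^ p)" and p: "p \<ge> 1"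
  shows "(\<integral>\<^sup>+x. ennreal (norm ((\<Sum>(k, l)\<in>B \<times> B. coeff f (k - l) * e (k - l) x) / card B) ^ p) \<partial>M)
    \<le> (\<integral>\<^sup>+x. ennreal (norm (f x) ^ p) \<partial>M)"
proof -
  define V where "V = measure M (space M)"
  define K where "K x y = (norm (dirichlet B x y))\<^sup>2 / (V * card B)" for x y
  have pos: "V * card B > 0" using B V by (simp add: V_def card_gt_0_iff)
  have K_nonneg: "K x y \<ge> 0" for x y using pos by (simp add: K_def)
  have [measurable]: "K x \<in> borel_measurable M" for x unfolding K_def by measurable
  have K_bounded: "K x y \<le> (real (card B))\<^sup>2 / (V * card B)" for x y
    unfolding K_def using pos dirichlet_bounded[OF B(1)] by (intro divide_right_mono power_mono) auto
  have K_int: "integrable M (\<lambda>y. K x y *\<^sub>R g y)" if "integrable M g" for x and g :: "'a \<Rightarrow> 'b::{banach, second_countable_topology}"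
  proof (rule Bochner_Integration.integrable_bound)
    show "integrable M (\<lambda>y. ((real (card B))\<^sup>2 / (V * card B)) *\<^sub>R g y)" using that by simp
    show "(\<lambda>y. K x y *\<^sub>R g y) \<in> borel_measurable M" using that by measurable
    show "AE y in M. norm (K x y *\<^sub>R g y) \<le> norm (((real (card B))\<^sup>2 / (V * card B)) *\<^sub>R g y)"
      using K_bounded K_nonneg pos by (auto intro!: mult_right_mono order_trans[OF K_bounded] simp del: times_divide_eq_left)
  qed
  have K_one: "(\<integral>y. K x y \<partial>M) = 1" for x
    using pos unfolding K_def by (simp add: integral_dirichlet_sq[OF B(1)] V_def [symmetric] zero_less_mult_iff)
  have f_int: "integrable M f" by (rule integrable_if_power_integrable[OF f fp p])
  \<comment> \<open>Expanding the squared kernel into characters turns the integral against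
    \<open>K x\<close> into coefficients of \<open>f\<close>, summed over all differences of
    elements of \<open>B\<close>.\<close>
  have mean: "(\<Sum>(k, l)\<in>B \<times> B. coeff f (k - l) * e (k - l) x) / card B = (\<integral>y. K x y *\<^sub>R f y \<partial>M)" for x
  proof -
    have int: "integrable M (\<lambda>y. cnj (e n y) * f y)" for n
      by (rule Bochner_Integration.integrable_bound[OF f_int]) (auto simp: norm_mult norm_e)
    have "(\<integral>y. K x y *\<^sub>R f y \<partial>M) = (\<integral>y. (\<Sum>(k, l)\<in>B \<times> B. e (k - l) x / (V * card B) * (cnj (e (k - l) y) * f y)) \<partial>M)"
      by (intro Bochner_Integration.integral_cong refl)
        (simp add: K_def scaleR_conv_of_real dirichlet_sq sum_divide_distrib sum_distrib_right sum_distrib_left split_beta mult_ac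
          del: of_real_power)
    also have "\<dots> = (\<Sum>(k, l)\<in>B \<times> B. e (k - l) x / (V * card B) * (\<integral>y. cnj (e (k - l) y) * f y \<partial>M))"
      using int by (simp add: split_beta)
    also have "\<dots> = (\<Sum>(k, l)\<in>B \<times> B. coeff f (k - l) * e (k - l) x) / card B"
      by (simp add: coeff_def V_def sum_divide_distrib split_beta mult_ac)
    finally show ?thesis ..
  qed
  \<comment> \<open>The tangent line of the power at the mean \<open>a\<close> is integrated against
    \<open>K x\<close>; total mass 1 makes its linear part vanish.\<close>
  have jensen: "norm (\<integral>y. K x y *\<^sub>R f y \<partial>M) ^ p \<le> (\<integral>y. K x y * norm (f y) ^ p \<partial>M)" for x
  proof -
    define a where "a = (\<integral>y. K x y * norm (f y) \<partial>M)"
    have int1: "integrable M (\<lambda>y. K x y * norm (f y))" using K_int[of "\<lambda>y. norm (f y)" x] f_int by simp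
    have int2: "integrable M (\<lambda>y. K x y * norm (f y) ^ p)" using K_int[of "\<lambda>y. norm (f y) ^ p" x] fp by simp
    have int3: "integrable M (K x)" using K_int[of "\<lambda>y. 1 :: real" x] by simp
    have "a \<ge> 0" unfolding a_def by (intro integral_nonneg_AE) (auto simp: K_nonneg)
    have "norm (\<integral>y. K x y *\<^sub>R f y \<partial>M) \<le> a"
      unfolding a_def using integral_norm_bound[of M "\<lambda>y. K x y *\<^sub>R f y"] by (simp add: K_nonneg)
    then have "norm (\<integral>y. K x y *\<^sub>R f y \<partial>M) ^ p \<le> a ^ p" by (intro power_mono) auto
    also have "\<dots> = (\<integral>y. (a ^ p - of_nat p * a ^ (p - 1) * a) * K x y + of_nat p * a ^ (p - 1) * (K x y * norm (f y)) \<partial>M)"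
      using int1 int3 by (simp add: K_one a_def [symmetric])
    also have "\<dots> \<le> (\<integral>y. K x y * norm (f y) ^ p \<partial>M)"
    proof (rule integral_mono)
      fix y
      have "K x y * (a ^ p + of_nat p * a ^ (p - 1) * (norm (f y) - a)) \<le> K x y * norm (f y) ^ p"
        using \<open>a \<ge> 0\<close> by (intro mult_left_mono power_ge_tangent K_nonneg) auto
      then show "(a ^ p - of_nat p * a ^ (p - 1) * a) * K x y + of_nat p * a ^ (p - 1) * (K x y * norm (f y))
        \<le> K x y * norm (f y) ^ p" by (simp add: algebra_simps)
    qed (use int1 int2 int3 in auto)
    finally show ?thesis .
  qed
  have sigma: "pair_sigma_finite M M" by unfold_locales
  have "(\<integral>\<^sup>+x. ennreal (norm (\<integral>y. K x y *\<^sub>R f y \<partial>M) ^ p) \<partial>M)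
    \<le> (\<integral>\<^sup>+x. (\<integral>\<^sup>+y. ennreal (K x y * norm (f y) ^ p) \<partial>M) \<partial>M)"
  proof (intro nn_integral_mono)
    fix x
    have "(\<integral>\<^sup>+y. ennreal (K x y * norm (f y) ^ p) \<partial>M) = ennreal (\<integral>y. K x y * norm (f y) ^ p \<partial>M)"
      using K_int[of "\<lambda>y. norm (f y) ^ p" x] fp by (intro nn_integral_eq_integral) (auto simp: K_nonneg)
    then show "ennreal (norm (\<integral>y. K x y *\<^sub>R f y \<partial>M) ^ p) \<le> (\<integral>\<^sup>+y. ennreal (K x y * norm (f y) ^ p) \<partial>M)"
      using jensen by (simp add: ennreal_leI)
  qed
  \<comment> \<open>After the exchange of integrals the first variable is integrated out; the
    symmetry of the kernel gives mass 1 there too.\<close>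
  also have "\<dots> = (\<integral>\<^sup>+y. (\<integral>\<^sup>+x. ennreal (K x y * norm (f y) ^ p) \<partial>M) \<partial>M)"
    unfolding K_def by (rule pair_sigma_finite.Fubini'[OF sigma, symmetric]) measurable
  also have "\<dots> = (\<integral>\<^sup>+y. ennreal (norm (f y) ^ p) \<partial>M)"
  proof (intro nn_integral_cong)
    fix y
    have K_sym: "K x y = K y x" for x by (simp add: K_def dirichlet_commute)
    have "(\<integral>\<^sup>+x. ennreal (K x y * norm (f y) ^ p) \<partial>M) = (\<integral>\<^sup>+x. ennreal (K y x) \<partial>M) * ennreal (norm (f y) ^ p)"
      by (simp add: K_sym ennreal_mult K_nonneg nn_integral_multc)
    also have "(\<integral>\<^sup>+x. ennreal (K y x) \<partial>M) = 1"
      using K_int[of "\<lambda>y. 1 :: real" y] by (subst nn_integral_eq_integral) (auto simp: K_nonneg K_one)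
    finally show "(\<integral>\<^sup>+x. ennreal (K x y * norm (f y) ^ p) \<partial>M) = ennreal (norm (f y) ^ p)" by simp
  qed
  finally show ?thesis by (simp only: mean)
qed

text \<open>The Fejer mean of \<open>f\<close> has coefficients \<open>r i n * coeff f n\<close>,
  where \<open>r i n\<close> counts the pairs in \<open>B i\<close> with difference
  \<open>n\<close>, relative to \<open>card (B i)\<close>. The hypothesis on polynomials applies to
  this mean, \<open>fejer_mean_bound\<close> removes the dependence on \<open>i\<close>, and since
  \<open>folner\<close> sends \<open>r i n\<close> to 1, Fatou's lemma gives the claim.\<close>

lemma multiplier_bound_from_trig:
  fixes B :: "nat \<Rightarrow> 'g set"
  assumes B: "\<And>i. finite (B i)" "\<And>i. B i \<noteq> {}"
    and folner: "\<And>m. (\<lambda>i. real (card {(k, l) \<in> B i \<times> B i. k - l = m}) / real (card (B i))) \<longlonglongrightarrow> 1"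
    and trig: "\<And>S c. finite S \<Longrightarrow> (\<integral>x. norm (\<Sum>n\<in>S \<inter> L. c n * e n x) ^ p \<partial>M)
      \<le> C * (\<integral>x. norm (\<Sum>n\<in>S. c n * e n x) ^ p \<partial>M)"
    and L: "finite L" and C: "C \<ge> 0" and V: "measure M (space M) > 0"
    and f [measurable]: "f \<in> borel_measurable M" and fp: "integrable M (\<lambda>x. norm (f x) ^ p)" and p: "p \<ge> 1"
  shows "(\<integral>\<^sup>+x. ennreal (norm (\<Sum>n\<in>L. coeff f n * e n x) ^ p) \<partial>M)
    \<le> ennreal C * (\<integral>\<^sup>+x. ennreal (norm (f x) ^ p) \<partial>M)"
proof -
  define r where "r i m = real (card {(k, l) \<in> B i \<times> B i. k - l = m}) / real (card (B i))" for i m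
  define s where "s i x = (\<Sum>n\<in>L. (r i n * coeff f n) * e n x)" for i x
  have s_trig: "s i \<in> trig UNIV" for i unfolding s_def using L by (intro trigI) auto
  have [measurable]: "s i \<in> borel_measurable M" for i using s_trig by (rule trig_measurable)
  have bound: "(\<integral>\<^sup>+x. ennreal (norm (s i x) ^ p) \<partial>M) \<le> ennreal C * (\<integral>\<^sup>+x. ennreal (norm (f x) ^ p) \<partial>M)" for i
  proof -
    \<comment> \<open>Adding \<open>L\<close> to the set of differences makes
      \<open>T \<inter> L\<close> equal to \<open>L\<close> and leaves the mean unchanged, as
      \<open>r i n\<close> is 0 when \<open>n\<close> is not a difference.\<close>
    define T where "T = (\<lambda>(k, l). k - l) ` (B i \<times> B i) \<union> L"
    have T: "finite T" using B L by (simp add: T_def)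
    define g where "g x = (\<Sum>n\<in>T. (r i n * coeff f n) * e n x)" for x
    have g_trig: "g \<in> trig UNIV" unfolding g_def using T by (intro trigI) auto
    have "T \<inter> L = L" by (auto simp: T_def)
    then have "(\<integral>x. norm (s i x) ^ p \<partial>M) \<le> C * (\<integral>x. norm (g x) ^ p \<partial>M)"
      using trig[OF T, of "\<lambda>n. r i n * coeff f n"] by (simp add: s_def g_def)
    then have "ennreal (\<integral>x. norm (s i x) ^ p \<partial>M) \<le> ennreal C * ennreal (\<integral>x. norm (g x) ^ p \<partial>M)"
      using C by (simp add: ennreal_mult' [symmetric] ennreal_leI)
    then have "(\<integral>\<^sup>+x. ennreal (norm (s i x) ^ p) \<partial>M) \<le> ennreal C * (\<integral>\<^sup>+x. ennreal (norm (g x) ^ p) \<partial>M)"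
      by (subst (1 2) nn_integral_eq_integral) (auto intro: trig_integrable_power s_trig g_trig)
    also have "(\<lambda>x. g x) = (\<lambda>x. (\<Sum>(k, l)\<in>B i \<times> B i. coeff f (k - l) * e (k - l) x) / card (B i))"
    proof
      fix x
      have "(\<Sum>(k, l)\<in>B i \<times> B i. coeff f (k - l) * e (k - l) x)
        = (\<Sum>m\<in>T. \<Sum>(k, l)\<in>{z \<in> B i \<times> B i. (\<lambda>(k, l). k - l) z = m}. coeff f (k - l) * e (k - l) x)"
        using B(1) T by (intro sum.group [symmetric]) (auto simp: T_def)
      also have "\<dots> = (\<Sum>m\<in>T. of_nat (card {(k, l) \<in> B i \<times> B i. k - l = m}) * (coeff f m * e m x))"
      proof (intro sum.cong refl)
        fix m
        have "(\<Sum>(k, l)\<in>{z \<in> B i \<times> B i. (\<lambda>(k, l). k - l) z = m}. coeff f (k - l) * e (k - l) x)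
          = (\<Sum>z\<in>{(k, l) \<in> B i \<times> B i. k - l = m}. coeff f m * e m x)"
          by (intro sum.cong) auto
        then show "(\<Sum>(k, l)\<in>{z \<in> B i \<times> B i. (\<lambda>(k, l). k - l) z = m}. coeff f (k - l) * e (k - l) x)
          = of_nat (card {(k, l) \<in> B i \<times> B i. k - l = m}) * (coeff f m * e m x)"
          by (simp only: sum_constant)
      qed
      finally show "g x = (\<Sum>(k, l)\<in>B i \<times> B i. coeff f (k - l) * e (k - l) x) / card (B i)"
        by (simp add: g_def r_def sum_divide_distrib mult_ac)
    qed
    also note fejer_mean_bound[OF B V f fp p]
    finally show ?thesis by (simp add: mult_left_mono)
  qed
  have lim: "(\<lambda>i. ennreal (norm (s i x) ^ p)) \<longlonglongrightarrow> ennreal (norm (\<Sum>n\<in>L. coeff f n * e n x) ^ p)" for x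
  proof -
    have "(\<lambda>i. s i x) \<longlonglongrightarrow> (\<Sum>n\<in>L. (complex_of_real 1 * coeff f n) * e n x)"
      unfolding s_def r_def by (intro tendsto_intros folner)
    then show ?thesis by (intro tendsto_ennrealI tendsto_intros) simp
  qed
  have "(\<integral>\<^sup>+x. ennreal (norm (\<Sum>n\<in>L. coeff f n * e n x) ^ p) \<partial>M)
    = (\<integral>\<^sup>+x. liminf (\<lambda>i. ennreal (norm (s i x) ^ p)) \<partial>M)"
    by (intro nn_integral_cong lim_imp_Liminf [symmetric] lim) simp
  also have "\<dots> \<le> liminf (\<lambda>i. \<integral>\<^sup>+x. ennreal (norm (s i x) ^ p) \<partial>M)"
    by (rule nn_integral_liminf) measurable
  also have "\<dots> \<le> ennreal C * (\<integral>\<^sup>+x. ennreal (norm (f x) ^ p) \<partial>M)"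
    by (intro Liminf_le always_eventually allI bound) simp
  finally show ?thesis .
qed

end

section \<open>The characters of the torus\<close>

lemma integral_exp_period:
  fixes k :: int
  assumes "k \<noteq> 0"
  shows "(\<integral>t. indicator {0..2 * pi} t *\<^sub>R exp (- \<i> * complex_of_real (of_int k * t)) \<partial>lborel) = 0"
proof -
  define F where "F t = exp (- \<i> * complex_of_real (of_int k * t)) / (- \<i> * of_int k)" for t :: real
  have "(\<integral>t. indicator {0..2 * pi} t *\<^sub>R exp (- \<i> * complex_of_real (of_int k * t)) \<partial>lborel)
    = F (2 * pi) - F 0"
  proof (rule integral_FTC_Icc)
    show "(F has_vector_derivative exp (- \<i> * complex_of_real (of_int k * t))) (at t within {0..2 * pi})" for t
      unfolding F_def using assms
      by (auto intro!: derivative_eq_intros has_vector_derivative_real_field simp: field_simps)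
  qed (auto intro!: continuous_intros)
  also have "F (2 * pi) = F 0"
  proof -
    have "exp (- \<i> * complex_of_real (of_int k * (2 * pi))) = exp (of_int (- k) * (of_real (2 * pi) * \<i>))"
      by (simp add: algebra_simps)
    also have "\<dots> = 1"
      by (subst exp_eq_1) (auto intro!: exI[of _ "-k"])
    finally show ?thesis by (simp add: F_def)
  qed
  finally show ?thesis by simp
qed

text \<open>The sign is that of the exponentials in \<open>fourier_sum\<close>; the exponential in
  \<open>fourier_coeff\<close> is then \<open>cnj (chr n x)\<close>, as \<open>coeff\<close>
  expects.\<close>

definition chr :: "int ^ 'd \<Rightarrow> real ^ 'd \<Rightarrow> complex" where
  "chr n x = exp (- \<i> * complex_of_real (char_pairing n x))"

lemma continuous_on_chr [continuous_intros]: "continuous_on S (chr n)"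
  unfolding chr_def char_pairing_def by (intro continuous_intros)

lemma measurable_chr: "chr n \<in> borel_measurable (lebesgue_on S)"
  by (intro measurable_restrict_space1 borel_measurable_continuous_onI measurable_completion)
     (simp add: borel_measurable_continuous_onI continuous_on_chr)

lemma norm_chr: "norm (chr n x) = 1"
  by (simp add: chr_def)

lemma chr_add: "chr (m + n) x = chr m x * chr n x"
  by (simp add: chr_def char_pairing_def exp_add [symmetric] algebra_simps sum.distrib)

text \<open>The indicator of the box and the character are both products of functions of single
  coordinates, so the integral splits into one-dimensional ones. The factor of a coordinate
  \<open>j\<close> with \<open>n $ j \<noteq> 0\<close> vanishes by periodicity.\<close>

lemma integral_chr:
  fixes n :: "int ^ 'd"
  assumes "n \<noteq> 0"
  shows "(\<integral>x. chr n x \<partial>lebesgue_on torus_box) = 0"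
proof -
  define v :: "real ^ 'd" where "v = (\<chi> j. of_int (n $ j))"
  define g where "g b t = indicator {0..2 * pi} t *\<^sub>R exp (- \<i> * complex_of_real ((v \<bullet> b) * t))"
    for b :: "real ^ 'd" and t :: real
  have box: "indicator torus_box x = (\<Prod>b\<in>Basis. indicator {0..2 * pi} (x \<bullet> b) :: real)" for x :: "real ^ 'd"
  proof -
    have "((\<chi> i. 2 * pi) :: real ^ 'd) \<bullet> b = 2 * pi" if "b \<in> Basis" for b
      using that by (auto simp: Basis_vec_def inner_axis)
    then have "x \<in> torus_box \<longleftrightarrow> (\<forall>b\<in>Basis. x \<bullet> b \<in> {0..2 * pi})"
      by (auto simp: torus_box_def mem_box)
    then show ?thesis
      by (cases "x \<in> torus_box") (auto simp: indicator_def)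
  qed
  have chr: "chr n x = (\<Prod>b\<in>Basis. exp (- \<i> * complex_of_real ((v \<bullet> b) * (x \<bullet> b))))" for x
  proof -
    have "char_pairing n x = v \<bullet> x"
      by (simp add: char_pairing_def v_def inner_vec_def)
    also have "\<dots> = (\<Sum>b\<in>Basis. (v \<bullet> b) * (x \<bullet> b))"
      by (rule euclidean_inner)
    finally show ?thesis
      by (simp add: chr_def exp_sum [symmetric] sum_distrib_left sum_negf)
  qed
  have eq: "indicator torus_box x *\<^sub>R chr n x = (\<Prod>b\<in>Basis. g b (x \<bullet> b))" for x
    by (simp add: box chr g_def scaleR_conv_of_real prod.distrib)
  have int_g: "integrable lborel (g b)" for b
    unfolding g_def
    by (intro borel_integrable_compact continuous_intros) auto
  have [measurable]: "(\<lambda>x. \<Prod>b\<in>Basis. g b (x \<bullet> b)) \<in> borel_measurable borel"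
    unfolding g_def by measurable
  have set: "torus_box \<in> sets (lebesgue :: (real ^ 'd) measure)"
    by (simp add: torus_box_def)
  obtain j where j: "n $ j \<noteq> 0"
    using assms by (auto simp: vec_eq_iff)
  have vj: "v \<bullet> axis j 1 = of_int (n $ j)"
    by (simp add: inner_axis v_def)
  interpret product_sigma_finite "\<lambda>_ :: real ^ 'd. lborel :: real measure" ..
  have "(\<integral>x. chr n x \<partial>lebesgue_on torus_box) = (\<integral>x. (\<Prod>b\<in>Basis. g b (x \<bullet> b)) \<partial>lebesgue)"
    using set by (subst integral_restrict_space) (auto simp: eq)
  also have "\<dots> = (\<integral>x. (\<Prod>b\<in>Basis. g b (x \<bullet> b)) \<partial>lborel)"
    by (rule integral_completion) simp
  also have "\<dots> = (\<integral>y. (\<Prod>b\<in>Basis. g b ((\<Sum>b\<in>Basis. y b *\<^sub>R b) \<bullet> b)) \<partial>(\<Pi>\<^sub>M b\<in>(Basis :: (real ^ 'd) set). lborel))"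
    by (subst lborel_eq, subst integral_distr) auto
  also have "\<dots> = (\<integral>y. (\<Prod>b\<in>Basis. g b (y b)) \<partial>(\<Pi>\<^sub>M b\<in>(Basis :: (real ^ 'd) set). lborel))"
    by (intro Bochner_Integration.integral_cong refl prod.cong) simp
  also have "\<dots> = (\<Prod>b\<in>(Basis :: (real ^ 'd) set). integral\<^sup>L lborel (g b))"
    by (rule product_integral_prod) (auto intro: int_g)
  also have "\<dots> = 0"
  proof (rule prod_zero)
    show "\<exists>b\<in>(Basis :: (real ^ 'd) set). integral\<^sup>L lborel (g b) = 0"
    proof
      show "integral\<^sup>L lborel (g (axis j 1)) = 0"
        unfolding g_def vj using integral_exp_period[OF j] by simp
    qed (auto simp: Basis_vec_def)
  qed simp
  finally show ?thesis .
qed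

lemma finite_measure_torus_box: "finite_measure (lebesgue_on torus_box)"
  by (simp add: torus_box_def finite_measure_lebesgue_on)

lemma measure_torus_box:
  "measure (lebesgue_on (torus_box :: (real ^ 'd) set)) torus_box = (2 * pi) ^ CARD('d)"
proof -
  have "measure (lebesgue_on (torus_box :: (real ^ 'd) set)) torus_box = measure lborel (torus_box :: (real ^ 'd) set)"
    by (simp add: measure_restrict_space torus_box_def)
  also have "\<dots> = (2 * pi) ^ CARD('d)"
    unfolding torus_box_def by (subst content_cbox_cart) (auto simp: interval_eq_empty_cart not_less)
  finally show ?thesis .
qed

section \<open>Cubes of frequencies\<close>

lemma max_norm_le_iff: "max_norm n \<le> k \<longleftrightarrow> (\<forall>j. \<bar>n $ j\<bar> \<le> k)"
  by (simp add: max_norm_def)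

lemma card_max_norm_le: "card {n :: int ^ 'd. max_norm n \<le> int i} = (2 * i + 1) ^ CARD('d)"
proof -
  have "{n :: int ^ 'd. max_norm n \<le> int i} = vec_lambda ` (UNIV \<rightarrow>\<^sub>E {- int i..int i})"
  proof (rule set_eqI)
    fix n :: "int ^ 'd"
    have "n = vec_lambda (vec_nth n)" by simp
    then show "n \<in> {n. max_norm n \<le> int i} \<longleftrightarrow> n \<in> vec_lambda ` (UNIV \<rightarrow>\<^sub>E {- int i..int i})"
      by (auto simp: max_norm_le_iff image_iff PiE_UNIV_domain Pi_iff abs_le_iff minus_le_iff intro!: bexI[of _ "vec_nth n"])
  qed
  also have "card \<dots> = card ((UNIV :: 'd set) \<rightarrow>\<^sub>E {- int i..int i})"
    by (rule card_image) (auto simp: inj_on_def vec_lambda_inject)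
  also have "\<dots> = (2 * i + 1) ^ CARD('d)"
  proof -
    have "nat (2 * int i + 1) = 2 * i + 1" by linarith
    then show ?thesis by (subst card_PiE) (auto simp: algebra_simps)
  qed
  finally show ?thesis .
qed

text \<open>With \<open>r\<close> bounding the coordinates of \<open>m\<close>, translation by
  \<open>m\<close> sends the cube of radius \<open>i - r\<close> into that of radius
  \<open>i\<close>, which bounds the count from below. The second entry determines the pair, which
  bounds it from above. The ratio of the two cube sizes tends to 1.\<close>

lemma cubes_folner:
  fixes m :: "int ^ 'd"
  defines "B \<equiv> \<lambda>i. {n :: int ^ 'd. max_norm n \<le> int i}"
  shows "(\<lambda>i. real (card {(k, l) \<in> B i \<times> B i. k - l = m}) / real (card (B i))) \<longlonglongrightarrow> 1"
proof (rule tendsto_sandwich)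
  define r where "r = nat (max_norm m)"
  have "\<bar>m $ j\<bar> \<le> max_norm m" for j using max_norm_le_iff[of m "max_norm m"] by simp
  then have r: "\<bar>m $ j\<bar> \<le> int r" for j
    unfolding r_def using order_trans[of "\<bar>m $ j\<bar>" "max_norm m" "int (nat (max_norm m))"] by simp
  have fin: "finite (B i)" for i unfolding B_def by (rule finite_max_norm_le)
  have fin2: "finite {(k, l) \<in> B i \<times> B i. k - l = m}" for i
    by (rule finite_subset[of _ "B i \<times> B i"]) (use fin in auto)
  have card_pos: "real (card (B i)) > 0" for i by (simp add: B_def card_max_norm_le)
  have "(2 * (i - r) + 1) ^ CARD('d) \<le> card {(k, l) \<in> B i \<times> B i. k - l = m}" if "i \<ge> r" for i
  proof -
    have "(\<lambda>l. (l + m, l)) ` B (i - r) \<subseteq> {(k, l) \<in> B i \<times> B i. k - l = m}"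
    proof (clarsimp simp: B_def max_norm_le_iff, intro conjI allI)
      fix l :: "int ^ 'd" and j :: 'd assume l: "\<forall>j. \<bar>l $ j\<bar> \<le> int (i - r)"
      show "\<bar>l $ j + m $ j\<bar> \<le> int i"
        using spec[OF l, of j] r[of j] that by (simp add: of_nat_diff)
      show "\<bar>l $ j\<bar> \<le> int i" using spec[OF l, of j] that by simp
    qed
    then have "card ((\<lambda>l. (l + m, l)) ` B (i - r)) \<le> card {(k, l) \<in> B i \<times> B i. k - l = m}"
      using fin2 by (intro card_mono) auto
    also have "card ((\<lambda>l. (l + m, l)) ` B (i - r)) = card (B (i - r))"
      by (rule card_image) (auto simp: inj_on_def)
    finally show ?thesis by (simp add: B_def card_max_norm_le)
  qed
  then have "real ((2 * (i - r) + 1) ^ CARD('d)) / real (card (B i))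
      \<le> real (card {(k, l) \<in> B i \<times> B i. k - l = m}) / real (card (B i))" if "i \<ge> r" for i
    using that by (intro divide_right_mono of_nat_mono) auto
  moreover have "real ((2 * (i - r) + 1) ^ CARD('d)) / real (card (B i)) = (1 - real (2 * r) / real (2 * i + 1)) ^ CARD('d)"
    if "i \<ge> r" for i
  proof -
    have "1 - real (2 * r) / real (2 * i + 1) = real (2 * (i - r) + 1) / real (2 * i + 1)"
      using that by (simp add: of_nat_diff field_simps)
    moreover have "card (B i) = (2 * i + 1) ^ CARD('d)" unfolding B_def by (rule card_max_norm_le)
    ultimately show ?thesis by (simp only: power_divide of_nat_power)
  qed
  ultimately have "\<forall>i\<ge>r. (1 - real (2 * r) / real (2 * i + 1)) ^ CARD('d)
      \<le> real (card {(k, l) \<in> B i \<times> B i. k - l = m}) / real (card (B i))" by simp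
  then show "\<forall>\<^sub>F i in sequentially. (1 - real (2 * r) / real (2 * i + 1)) ^ CARD('d)
      \<le> real (card {(k, l) \<in> B i \<times> B i. k - l = m}) / real (card (B i))"
    by (auto simp: eventually_sequentially)
  have "filterlim (\<lambda>i. real (2 * i + 1)) at_top sequentially"
    by (rule filterlim_compose[OF filterlim_real_sequentially filterlim_subseq]) (simp add: strict_mono_def)
  then have "(\<lambda>i. real (2 * r) / real (2 * i + 1)) \<longlonglongrightarrow> 0"
    by (rule real_tendsto_divide_at_top[OF tendsto_const])
  then have "(\<lambda>i. (1 - real (2 * r) / real (2 * i + 1)) ^ CARD('d)) \<longlonglongrightarrow> (1 - 0) ^ CARD('d)"
    by (intro tendsto_power tendsto_diff tendsto_const)
  then show "(\<lambda>i. (1 - real (2 * r) / real (2 * i + 1)) ^ CARD('d)) \<longlonglongrightarrow> 1" by simp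
  have "card {(k, l) \<in> B i \<times> B i. k - l = m} \<le> card (B i)" for i
  proof -
    have "card {(k, l) \<in> B i \<times> B i. k - l = m} = card (snd ` {(k, l) \<in> B i \<times> B i. k - l = m})"
      by (rule card_image [symmetric]) (auto simp: inj_on_def algebra_simps)
    also have "\<dots> \<le> card (B i)" using fin by (intro card_mono) auto
    finally show ?thesis .
  qed
  then show "\<forall>\<^sub>F i in sequentially. real (card {(k, l) \<in> B i \<times> B i. k - l = m}) / real (card (B i)) \<le> 1"
    using card_pos by (intro always_eventually allI) (simp add: divide_le_eq_1)
qed simp

section \<open>Power bounds and linearity for the partial sums\<close>

interpretation torus: character_system "lebesgue_on torus_box" "chr :: int ^ 'd \<Rightarrow> real ^ 'd \<Rightarrow> complex"
proof -
  interpret finite_measure "lebesgue_on (torus_box :: (real ^ 'd) set)"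
    by (rule finite_measure_torus_box)
  show "character_system (lebesgue_on torus_box) (chr :: int ^ 'd \<Rightarrow> real ^ 'd \<Rightarrow> complex)"
    by unfold_locales (simp_all add: measurable_chr norm_chr chr_add integral_chr)
qed

lemma fourier_coeff_eq: "fourier_coeff f n = torus.coeff f n"
  by (simp add: fourier_coeff_def torus.coeff_def measure_torus_box chr_def exp_cnj)

lemma fourier_sum_eq:
  "fourier_sum m f x = (\<Sum>n | max_norm n \<le> int m. torus.coeff f n * chr n x)"
  by (simp add: fourier_sum_def fourier_coeff_eq chr_def)

lemma fourier_sum_measurable: "fourier_sum m f \<in> borel_measurable (lebesgue_on torus_box)"
proof -
  have "fourier_sum m f = (\<lambda>x. \<Sum>n | max_norm n \<le> int m. torus.coeff f n * chr n x)"
    by (rule ext) (rule fourier_sum_eq)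
  then show ?thesis by simp
qed

text \<open>The cube of frequencies is an intersection of \<open>CARD('d)\<close> coordinate strips,
  so for \<open>p = 2 ^ Suc k\<close> the operator norm is at most
  \<open>(p - 1) ^ CARD('d)\<close>, uniformly in \<open>m\<close>. The constant here is the
  \<open>p\<close>-th power of that.\<close>

lemma fourier_sum_Lp_bound:
  fixes f :: "real ^ 'd \<Rightarrow> complex"
  assumes "f \<in> borel_measurable (lebesgue_on torus_box)"
    and "integrable (lebesgue_on torus_box) (\<lambda>x. norm (f x) ^ (2 ^ Suc k))"
  shows "(\<integral>\<^sup>+x. ennreal (norm (fourier_sum m f x) ^ (2 ^ Suc k)) \<partial>lebesgue_on torus_box)
    \<le> ennreal (((2 ^ Suc k - 1) ^ (2 ^ Suc k)) ^ CARD('d))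
      * (\<integral>\<^sup>+x. ennreal (norm (f x) ^ (2 ^ Suc k)) \<partial>lebesgue_on torus_box)"
  unfolding fourier_sum_eq
proof (rule torus.multiplier_bound_from_trig[where B = "\<lambda>i. {n. max_norm n \<le> int i}"])
  show "(\<lambda>i. real (card {(k, l) \<in> {n. max_norm n \<le> int i} \<times> {n. max_norm n \<le> int i}. k - l = m})
    / real (card {n :: int ^ 'd. max_norm n \<le> int i})) \<longlonglongrightarrow> 1" for m :: "int ^ 'd"
    by (rule cubes_folner)
  show "{n :: int ^ 'd. max_norm n \<le> int i} \<noteq> {}" for i
    using card_max_norm_le[of i, where 'd = 'd] by (metis card.empty power_eq_0_iff add_is_0 one_neq_zero)
  show "measure (lebesgue_on torus_box) (space (lebesgue_on (torus_box :: (real ^ 'd) set))) > 0"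
    by (simp add: measure_torus_box)
  show "0 \<le> (((2::real) ^ Suc k - 1) ^ (2 ^ Suc k)) ^ CARD('d)"
    using one_le_power[of "2 :: real" "Suc k"] by (intro zero_le_power) linarith
  fix S :: "(int ^ 'd) set" and c assume "finite S"
  have surj: "surj (\<lambda>n :: int ^ 'd. n $ j)" for j
    by (rule surjI[of _ "\<lambda>a. \<chi> i. a"]) simp
  have "S \<inter> {n. max_norm n \<le> int m} = {n \<in> S. \<forall>j\<in>UNIV. \<bar>n $ j\<bar> \<le> int m}"
    by (auto simp: max_norm_le_iff)
  then show "(\<integral>x. norm (\<Sum>n\<in>S \<inter> {n. max_norm n \<le> int m}. c n * chr n x) ^ (2 ^ Suc k) \<partial>lebesgue_on torus_box)
    \<le> ((2 ^ Suc k - 1) ^ (2 ^ Suc k)) ^ CARD('d)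
      * (\<integral>x. norm (\<Sum>n\<in>S. c n * chr n x) ^ (2 ^ Suc k) \<partial>lebesgue_on torus_box)"
    using torus.cube_multiplier_bound[where \<phi> = "\<lambda>j n. n $ j", OF _ surj \<open>finite S\<close>, of "int m" UNIV c k] by simp
qed (use assms in \<open>simp_all add: finite_max_norm_le\<close>)

lemma fourier_sum_cmult:
  assumes "integrable (lebesgue_on torus_box) f"
  shows "fourier_sum m (\<lambda>x. a * f x) x = a * fourier_sum m f x"
proof -
  have "fourier_coeff (\<lambda>x. a * f x) n = a * fourier_coeff f n" for n
    by (simp add: fourier_coeff_def mult.left_commute[of _ a])
  then show ?thesis by (simp add: fourier_sum_def sum_distrib_left mult.assoc)
qed

lemma fourier_sum_add:
  assumes f: "integrable (lebesgue_on torus_box) f" and g: "integrable (lebesgue_on torus_box) g"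
  shows "fourier_sum m (\<lambda>x. f x + g x) x = fourier_sum m f x + fourier_sum m g x"
proof -
  have int: "integrable (lebesgue_on torus_box) (\<lambda>x. cnj (chr n x) * h x)"
    if "integrable (lebesgue_on torus_box) h" for h n
    using that by (rule Bochner_Integration.integrable_bound)
      (use that in \<open>auto simp: norm_mult norm_chr\<close>)
  have "torus.coeff (\<lambda>x. f x + g x) n = torus.coeff f n + torus.coeff g n" for n
    using int[OF f, of n] int[OF g, of n] by (simp add: torus.coeff_def distrib_left add_divide_distrib)
  then show ?thesis by (simp add: fourier_sum_eq distrib_right sum.distrib)
qed

section \<open>Orlicz functions of the class\<close>

text \<open>The bound is sharpened to \<open>2 / x\<close> for \<open>x \<ge> 1\<close> and
  \<open>4 - x\<close> otherwise, so that the induction closes when the first term is split off and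
  \<open>x\<close> is doubled.\<close>

lemma sum_min_geometric_le:
  fixes x :: real
  assumes "x > 0"
  shows "(\<Sum>i<n. min (x * 2 ^ i) (1 / (x * 2 ^ i))) \<le> 4"
proof -
  have "(\<Sum>i<n. min (x * 2 ^ i) (1 / (x * 2 ^ i))) \<le> (if x \<ge> 1 then 2 / x else 4 - x)"
    using assms
  proof (induction n arbitrary: x)
    case 0
    then show ?case by auto
  next
    case (Suc n)
    have "(\<Sum>i<Suc n. min (x * 2 ^ i) (1 / (x * 2 ^ i)))
      = min x (1 / x) + (\<Sum>i<n. min ((2 * x) * 2 ^ i) (1 / ((2 * x) * 2 ^ i)))"
      unfolding sum.lessThan_Suc_shift by (simp add: mult_ac)
    also have "(\<Sum>i<n. min ((2 * x) * 2 ^ i) (1 / ((2 * x) * 2 ^ i))) \<le> (if 2 * x \<ge> 1 then 2 / (2 * x) else 4 - 2 * x)"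
      using Suc.prems by (intro Suc.IH) simp
    also have "min x (1 / x) + (if 2 * x \<ge> 1 then 2 / (2 * x) else 4 - 2 * x) \<le> (if x \<ge> 1 then 2 / x else 4 - x)"
    proof (cases "x \<ge> 1")
      case True
      then have "min x (1 / x) \<le> 1 / x" by simp
      moreover have "1 / x + 2 / (2 * x) = 2 / x" by (simp add: field_simps)
      ultimately show ?thesis using True by auto
    next
      case False
      show ?thesis
      proof (cases "2 * x \<ge> 1")
        case True
        have "2 / (2 * x) \<le> 2" using True Suc.prems by (simp add: field_simps)
        moreover have "min x (1 / x) \<le> x" by simp
        ultimately show ?thesis using True False by simp
      qed (use False in auto)
    qed
    finally show ?case by simp
  qed
  also have "\<dots> \<le> 4" using assms by (auto simp: field_simps)
  finally show ?thesis .
qed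

lemma suminf_min_geometric_le:
  fixes x :: real
  assumes "x \<ge> 0"
  shows "(\<Sum>i. ennreal (min (x * 2 ^ i) (1 / (x * 2 ^ i)))) \<le> 4"
\<comment> \<open>The value 0 arises later from a quotient by \<open>norm (g x)\<close> where
  \<open>g\<close> vanishes, division by zero being 0; every term of the series is then 0.\<close>
proof (cases "x = 0")
  case False
  have "(\<Sum>i<n. ennreal (min (x * 2 ^ i) (1 / (x * 2 ^ i)))) \<le> 4" for n
  proof -
    have "(\<Sum>i<n. ennreal (min (x * 2 ^ i) (1 / (x * 2 ^ i))))
      = ennreal (\<Sum>i<n. min (x * 2 ^ i) (1 / (x * 2 ^ i)))"
      using assms by (intro sum_ennreal) auto
    also have "\<dots> \<le> ennreal 4"
      using False assms by (intro ennreal_leI sum_min_geometric_le) auto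
    finally show ?thesis by simp
  qed
  then show ?thesis by (subst suminf_eq_SUP) (rule SUP_least)
qed simp

lemma dyadic_bracket:
  fixes x :: real
  assumes "x > 2 ^ k"
  obtains n where "n \<ge> k" "2 ^ n < x" "x \<le> 2 ^ Suc n"
proof -
  define n where "n = (LEAST n. x \<le> 2 ^ n)"
  have "\<exists>n. x \<le> 2 ^ n" using real_arch_pow[of 2 x] by (auto intro: less_imp_le)
  then have n: "x \<le> 2 ^ n" unfolding n_def by (rule LeastI_ex)
  have less: "2 ^ i < x" if "i < n" for i
    using not_less_Least[of i "\<lambda>n. x \<le> 2 ^ n"] that by (simp add: n_def not_le)
  have "k < n"
  proof (rule ccontr)
    assume "\<not> k < n"
    then have "(2::real) ^ n \<le> 2 ^ k" by (intro power_increasing) auto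
    then show False using n assms by linarith
  qed
  then obtain i where i: "n = Suc i" by (cases n) auto
  show ?thesis by (rule that[of i]) (use i n less \<open>k < n\<close> in auto)
qed

lemma power_le_fact_exp:
  fixes p :: real
  assumes "p \<ge> 0"
  shows "p ^ d \<le> fact d * exp p"
proof -
  have "p ^ d / fact d \<le> (\<Sum>n. p ^ n /\<^sub>R fact n)"
    using sum_le_suminf[of "\<lambda>n. p ^ n /\<^sub>R fact n" "{d}"] summable_exp_generic[of p] assms
    by (simp add: field_simps)
  then show ?thesis by (simp add: exp_def field_simps)
qed

text \<open>With \<open>z = x / p ^ d\<close> the left side is
  \<open>exp (- p) * z powr (p - s)\<close>. The hypotheses on \<open>s\<close> leave an exponent of
  at least 1 when \<open>z < 1\<close> and of at most -1 otherwise, and \<open>exp (- p)\<close>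
  pays for the factor \<open>p ^ d\<close> by \<open>power_le_fact_exp\<close>. The resulting decay
  on both sides makes the dyadic levels summable.\<close>

lemma weight_bound:
  fixes p x s :: real
  assumes p: "p \<ge> 1" and x: "x > 0" and s: "s > 0"
    and below: "x < p ^ d \<Longrightarrow> s \<le> p - 1" and above: "x \<ge> p ^ d \<Longrightarrow> s \<ge> p + 1"
  shows "exp (- p) * (x / p ^ d) powr p * (p ^ d / x) powr s \<le> fact d * min x (1 / x)"
proof -
  define z where "z = x / p ^ d"
  have pd: "p ^ d \<ge> 1" using p by simp
  have z: "z > 0" using x pd by (simp add: z_def)
  have eq: "p ^ d / x = z powr (- 1)" using x pd by (simp add: z_def powr_minus_divide)
  have "(p ^ d / x) powr s = z powr (- s)" by (simp only: eq powr_powr) simp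
  then have "exp (- p) * (x / p ^ d) powr p * (p ^ d / x) powr s = exp (- p) * z powr (p - s)"
    by (simp add: z_def [symmetric] powr_add [symmetric])
  also have "\<dots> \<le> fact d * min x (1 / x)"
  proof (cases "x < p ^ d")
    case True
    then have "z < 1" using pd by (simp add: z_def)
    then have "z powr (p - s) \<le> z powr 1" using below[OF True] z by (intro powr_mono') auto
    then have *: "exp (- p) * z powr (p - s) \<le> exp (- p) * z" using z by simp
    have "exp (- p) * z \<le> 1 * x"
      using pd p x by (intro mult_mono) (auto simp: z_def divide_le_eq mult_le_cancel_left1)
    also have "\<dots> \<le> fact d * x" using x by (simp add: fact_ge_1)
    finally have 1: "exp (- p) * z \<le> fact d * x" .
    have "exp (- p) * z \<le> exp (- p)" using \<open>z < 1\<close> by simp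
    also have "\<dots> \<le> fact d / p ^ d"
      using power_le_fact_exp[of p d] p pd by (simp add: exp_minus field_simps)
    also have "\<dots> \<le> fact d / x" using True x by (intro divide_left_mono) auto
    finally have "exp (- p) * z \<le> fact d * (1 / x)" by simp
    with 1 have "exp (- p) * z \<le> fact d * min x (1 / x)" by (simp add: min_def)
    with * show ?thesis by (rule order_trans)
  next
    case False
    then have "z \<ge> 1" using pd by (simp add: z_def)
    then have "z powr (p - s) \<le> z powr (- 1)" using above False by (intro powr_mono) auto
    also have "\<dots> = p ^ d / x" by (simp only: eq)
    finally have "exp (- p) * z powr (p - s) \<le> exp (- p) * (p ^ d / x)" by (intro mult_left_mono) auto
    also have "\<dots> = exp (- p) * p ^ d / x" by simp
    also have "\<dots> \<le> fact d / x"
      using power_le_fact_exp[of p d] p x by (intro divide_right_mono) (auto simp: exp_minus field_simps)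
    finally have *: "exp (- p) * z powr (p - s) \<le> fact d / x" .
    have "x \<ge> 1" using False pd by simp
    then have "1 / x \<le> x" by (simp add: field_simps) (smt (verit) mult_le_cancel_left1)
    then have "min x (1 / x) = 1 / x" by (rule min_absorb2)
    with * show ?thesis by simp
  qed
  finally show ?thesis .
qed

section \<open>Powers below an Orlicz function\<close>

lemma Psi_class_pos: "\<psi> \<in> Psi_class \<alpha> \<Longrightarrow> p \<ge> \<alpha> \<Longrightarrow> \<psi> p > 0"
  by (simp add: Psi_class_def)

lemma orlicz_fun_ge_power:
  assumes "\<alpha> \<ge> 1" "\<psi> \<in> Psi_class \<alpha>" "is_orlicz_fun \<alpha> \<psi> N" "p \<ge> \<alpha>" "y \<ge> exp 2"
  shows "(y / \<psi> p) powr p \<le> N y"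
proof -
  have y: "y > 0" using assms(5) exp_gt_zero[of "2::real"] by linarith
  have "p * ln \<bar>y\<bar> - p * ln (\<psi> p) \<le> (SUP p\<in>{\<alpha>..}. p * ln \<bar>y\<bar> - p * ln (\<psi> p))"
    using assms y by (intro cSUP_upper Psi_class_bdd_above) auto
  moreover have "N y = exp (SUP p\<in>{\<alpha>..}. p * ln \<bar>y\<bar> - p * ln (\<psi> p))"
    using assms y by (simp add: is_orlicz_fun_def)
  moreover have "(y / \<psi> p) powr p = exp (p * ln \<bar>y\<bar> - p * ln (\<psi> p))"
    using y Psi_class_pos[OF assms(2,4)] by (simp add: powr_def ln_div algebra_simps)
  ultimately show ?thesis by simp
qed

lemma orlicz_fun_mono:
  assumes "is_orlicz_fun \<alpha> \<psi> N" "0 \<le> x" "x \<le> y"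
  shows "N x \<le> N y"
  using assms strict_mono_on_leD[of "{0..}" N x y] by (auto simp: is_orlicz_fun_def)

lemma orlicz_fun_nonneg:
  assumes "is_orlicz_fun \<alpha> \<psi> N"
  shows "N x \<ge> 0"
proof -
  have "N x = N \<bar>x\<bar>" using assms by (auto simp: is_orlicz_fun_def abs_if)
  moreover have "N 0 = 0" using assms by (simp add: is_orlicz_fun_def)
  ultimately show ?thesis using orlicz_fun_mono[OF assms, of 0 "\<bar>x\<bar>"] by simp
qed

lemma orlicz_fun_majorant:
  assumes "\<alpha> \<ge> 1" "\<psi> \<in> Psi_class \<alpha>" "is_orlicz_fun \<alpha> \<psi> N" "p \<ge> \<alpha>" "y \<ge> 0"
  shows "(y / \<psi> p) powr p \<le> N y + N (exp 2)"
proof (cases "y \<ge> exp 2")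
  case True
  then show ?thesis using orlicz_fun_ge_power[OF assms(1-4)] orlicz_fun_nonneg[OF assms(3), of "exp 2"]
    by (smt (verit))
next
  case False
  have "(y / \<psi> p) powr p \<le> (exp 2 / \<psi> p) powr p"
    using False assms Psi_class_pos[OF assms(2,4)] by (intro powr_mono2 divide_right_mono) auto
  also have "\<dots> \<le> N (exp 2)" using orlicz_fun_ge_power[OF assms(1-4)] by simp
  finally show ?thesis using orlicz_fun_nonneg[OF assms(3), of y] by simp
qed

text \<open>For large arguments the supremum defining \<open>N\<close> is almost attained at an exponent
  \<open>p \<ge> 3\<close>, which leaves room for the endpoint exponent 2 of the interpolation below it.\<close>

lemma orlicz_fun_near_maximiser:
  assumes \<alpha>: "\<alpha> \<ge> 1" and \<psi>: "\<psi> \<in> Psi_class \<alpha>"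
  shows "\<exists>k\<ge>4. \<forall>N v. is_orlicz_fun \<alpha> (psi_pow d \<psi>) N \<longrightarrow> v \<ge> 2 ^ k \<longrightarrow>
      (\<exists>p\<ge>\<alpha>. p \<ge> 3 \<and> N v \<le> 2 * (v / (p ^ d * \<psi> p)) powr p)"
proof -
  \<comment> \<open>Once \<open>ln v \<ge> L\<close>, the exponent 4 beats every admissible exponent
    below 3 by more than \<open>ln 2\<close>; such an exponent forces \<open>\<alpha> < 3\<close>,
    so 4 is admissible as well. Since \<open>L\<close> depends only on \<open>\<alpha>\<close>,
    \<open>\<psi>\<close> and \<open>d\<close>, the same \<open>k\<close> serves all versions
    \<open>N\<close>.\<close>
  define L where "L = 3 * \<bar>ln (\<psi> \<alpha>)\<bar> + 4 * \<bar>ln (4 ^ d * \<psi> 4)\<bar> + 2"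
  obtain k0 where "exp L < 2 ^ k0" using real_arch_pow[of 2 "exp L"] by auto
  moreover define k where "k = k0 + 4"
  moreover have "(2::real) ^ k0 \<le> 2 ^ k" unfolding k_def by (intro power_increasing) auto
  ultimately have k: "exp L \<le> 2 ^ k" by linarith
  have "\<exists>p\<ge>\<alpha>. p \<ge> 3 \<and> N v \<le> 2 * (v / (p ^ d * \<psi> p)) powr p"
    if N: "is_orlicz_fun \<alpha> (psi_pow d \<psi>) N" and v: "v \<ge> 2 ^ k" for N v
  proof -
    define val where "val p = p * ln \<bar>v\<bar> - p * ln (psi_pow d \<psi> p)" for p
    have vL: "v \<ge> exp L" using v k by linarith
    have v0: "v > 0" using vL exp_gt_zero[of L] by linarith
    have lnv: "ln v \<ge> L" using vL v0 by (simp add: ln_ge_iff)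
    have "L \<ge> 2" by (simp add: L_def)
    then have "v \<ge> exp 2" using vL by (smt (verit) exp_le_cancel_iff)
    then have Nv: "N v = exp (SUP p\<in>{\<alpha>..}. val p)"
      using N v0 by (simp add: is_orlicz_fun_def val_def)
    have ln_psi: "ln (psi_pow d \<psi> p) \<ge> ln (\<psi> p)" "psi_pow d \<psi> p > 0" if "p \<ge> \<alpha>" for p
    proof -
      have "p ^ d \<ge> 1" using \<alpha> that by simp
      then have "1 * \<psi> p \<le> p ^ d * \<psi> p" using Psi_class_pos[OF \<psi> that] by (intro mult_right_mono) auto
      then show "ln (psi_pow d \<psi> p) \<ge> ln (\<psi> p)" "psi_pow d \<psi> p > 0"
        using Psi_class_pos[OF \<psi> that] by (simp_all add: psi_pow_def)
    qed
    have val_le: "val p \<le> p * ln \<bar>v\<bar> - p * ln (\<psi> p)" if "p \<ge> \<alpha>" for p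
      using ln_psi(1)[OF that] \<alpha> that by (simp add: val_def mult_left_mono)
    have "bdd_above ((\<lambda>p. p * ln \<bar>v\<bar> - p * ln (\<psi> p)) ` {\<alpha>..})"
      using v0 by (intro Psi_class_bdd_above \<alpha> \<psi>) auto
    then obtain K where "\<And>p. p \<ge> \<alpha> \<Longrightarrow> p * ln \<bar>v\<bar> - p * ln (\<psi> p) \<le> K"
      by (auto simp: bdd_above_def)
    then have bdd: "bdd_above (val ` {\<alpha>..})"
      using val_le by (intro bdd_aboveI2[of _ _ K]) (auto intro: order_trans)
    \<comment> \<open>A distance of \<open>ln 2\<close> from the supremum becomes the factor 2 after
      exponentiation.\<close>
    have "(SUP p\<in>{\<alpha>..}. val p) - ln 2 < (SUP p\<in>{\<alpha>..}. val p)" by simp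
    then obtain p where p: "p \<ge> \<alpha>" "(SUP p\<in>{\<alpha>..}. val p) - ln 2 < val p"
      by (subst (asm) less_cSUP_iff) (use bdd in auto)
    have "p \<ge> 3"
    proof (rule ccontr)
      assume "\<not> p \<ge> 3"
      then have p3: "p < 3" "\<alpha> \<le> 4" using p by auto
      have "val 4 \<le> (SUP p\<in>{\<alpha>..}. val p)" using p3 bdd by (intro cSUP_upper) auto
      moreover have "val 4 = 4 * ln v - 4 * ln (4 ^ d * \<psi> 4)" using v0 by (simp add: val_def psi_pow_def)
      moreover have "val p \<le> 3 * ln v + 3 * \<bar>ln (\<psi> \<alpha>)\<bar>"
      proof -
        have "\<psi> \<alpha> \<le> \<psi> p"
          using \<psi> p strict_mono_on_leD[of "{\<alpha>..}" \<psi> \<alpha> p] by (auto simp: Psi_class_def)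
        then have "ln (\<psi> p) \<ge> - \<bar>ln (\<psi> \<alpha>)\<bar>"
          using Psi_class_pos[OF \<psi>, of \<alpha>] by (smt (verit) ln_le_cancel_iff order_refl)
        then have "p * ln (\<psi> p) \<ge> p * (- \<bar>ln (\<psi> \<alpha>)\<bar>)" using p \<alpha> by (intro mult_left_mono) auto
        moreover have "p * \<bar>ln (\<psi> \<alpha>)\<bar> \<le> 3 * \<bar>ln (\<psi> \<alpha>)\<bar>" using p3 by (intro mult_right_mono) auto
        moreover have "p * ln v \<le> 3 * ln v" using p3 lnv \<open>L \<ge> 2\<close> by (intro mult_right_mono) auto
        ultimately show ?thesis using val_le[OF p(1)] v0 by simp
      qed
      moreover have "ln 2 < (2 :: real)" using ln_2_less_1 by simp
      ultimately have "ln v < L" using p(2) unfolding L_def by linarith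
      then show False using lnv by simp
    qed
    moreover have "N v \<le> 2 * (v / (p ^ d * \<psi> p)) powr p"
    proof -
      have "N v \<le> exp (ln 2 + val p)" unfolding Nv using p(2) by simp
      also have "\<dots> = 2 * exp (val p)" by (simp add: exp_add)
      also have "exp (val p) = (v / psi_pow d \<psi> p) powr p"
        using v0 ln_psi(2)[OF p(1)] by (simp add: val_def powr_def ln_div algebra_simps)
      finally show ?thesis by (simp add: psi_pow_def)
    qed
    ultimately show ?thesis using p(1) by blast
  qed
  moreover have "k \<ge> 4" by (simp add: k_def)
  ultimately show ?thesis by blast
qed

section \<open>Interpolation\<close>

text \<open>In terms of \<open>x = c * u / y\<close> the cut reads \<open>x < p ^ d\<close>. The
  bound on \<open>W\<close> contributes \<open>exp (- p) * (x / p ^ d) powr p\<close>, up to the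
  factor \<open>2 * n\<close>, and the bracket is at most a power of \<open>p ^ d / x\<close> with
  exponent 2 above the cut and \<open>q\<close> below it. As \<open>2 \<le> p - 1\<close> and
  \<open>q \<ge> p + 1\<close>, these are the two regimes of \<open>weight_bound\<close>.\<close>

lemma interpolation_weight_bound:
  fixes p s u W y n :: real and q d :: nat
  defines "c \<equiv> 2 * exp 1" and "C \<equiv> 4 * exp 1 * 4 ^ d"
  assumes p: "p \<ge> 3" and s: "s > 0" and u: "u > 0" and y: "y \<ge> 0"
    and q: "p + 1 \<le> q" "q \<le> 4 * p"
    and W: "0 \<le> W" "W \<le> 2 * (2 * u / (p ^ d * s)) powr p" and n: "(y / s) powr p \<le> n"
  shows "W * ((2 / (C * u)) ^ 2 * (if y > c * u / p ^ d then y else 0) ^ 2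
      + (2 / (C * u)) ^ q * (real q ^ d) ^ q * (if y > c * u / p ^ d then 0 else y) ^ q)
    \<le> 2 * fact d * n * min (c * u / y) (1 / (c * u / y))"
\<comment> \<open>At \<open>y = 0\<close> both sides vanish, the right one because division by zero
  gives 0.\<close>
proof (cases "y = 0")
  case True
  moreover have "c * u / p ^ d > 0" using p u by (simp add: c_def)
  moreover have "q > 0" using q(1) p by (cases q) auto
  ultimately show ?thesis by (simp add: power_0_left)
next
  case False
  define x where "x = c * u / y"
  have y0: "y > 0" using False y by simp
  have c: "c > 0" by (simp add: c_def)
  have C: "C = 2 * c * 4 ^ d" by (simp add: C_def c_def)
  have x: "x > 0" using c u y0 by (simp add: x_def)
  have pd: "p ^ d > 0" using p by simp
  have cut: "y > c * u / p ^ d \<longleftrightarrow> x < p ^ d" using y0 pd by (simp add: x_def field_simps)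
  have n0: "n \<ge> 0" using n powr_ge_zero order_trans by blast
  have W': "W \<le> 2 * (exp (- p) * (x / p ^ d) powr p) * n"
  proof -
    \<comment> \<open>The factor \<open>exp 1\<close> in \<open>c\<close> is what produces the
      \<open>exp (- p)\<close> of \<open>weight_bound\<close>.\<close>
    have "2 * u / (p ^ d * s) = exp (- 1) * (x / p ^ d) * (y / s)"
      using y0 by (simp add: x_def c_def exp_minus field_simps)
    also have "\<dots> powr p = exp (- p) * (x / p ^ d) powr p * (y / s) powr p"
    proof -
      have "exp (- 1) powr p = exp (- p)" by (simp add: powr_def)
      then show ?thesis by (simp only: powr_mult)
    qed
    also have "\<dots> \<le> exp (- p) * (x / p ^ d) powr p * n" using n by (intro mult_left_mono) auto
    finally show ?thesis using W(2) by (simp add: mult_ac)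
  qed
  have "W * ((2 / (C * u)) ^ 2 * (if y > c * u / p ^ d then y else 0) ^ 2
      + (2 / (C * u)) ^ q * (real q ^ d) ^ q * (if y > c * u / p ^ d then 0 else y) ^ q)
    \<le> W * (p ^ d / x) powr (if x < p ^ d then 2 else real q)"
  proof (intro mult_left_mono W(1))
    show "(2 / (C * u)) ^ 2 * (if y > c * u / p ^ d then y else 0) ^ 2
      + (2 / (C * u)) ^ q * (real q ^ d) ^ q * (if y > c * u / p ^ d then 0 else y) ^ q
      \<le> (p ^ d / x) powr (if x < p ^ d then 2 else real q)"
    proof (cases "x < p ^ d")
      case True
      have "2 / (C * u) * y = 1 / 4 ^ d / x" using y0 u c by (simp add: x_def C field_simps)
      also have "\<dots> \<le> p ^ d / x"
      proof (rule divide_right_mono)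
        have "1 / 4 ^ d \<le> (1::real)" by simp
        also have "1 \<le> p ^ d" using p by simp
        finally show "1 / 4 ^ d \<le> p ^ d" .
      qed (use x in simp)
      finally have "(2 / (C * u) * y) ^ 2 \<le> (p ^ d / x) ^ 2"
        using y0 u c by (intro power_mono) (auto simp: C)
      then have "(2 / (C * u)) ^ 2 * y ^ 2 \<le> (p ^ d / x) ^ 2" by (simp only: power_mult_distrib)
      then show ?thesis using True x pd q(1) p by (simp add: cut powr_numeral power_0_left)
    next
      case False
      \<comment> \<open>The factor \<open>4 ^ d\<close> in \<open>C\<close> absorbs the loss from
        \<open>q \<le> 4 * p\<close>.\<close>
      have "2 / (C * u) * real q ^ d * y = (real q / 4) ^ d / x"
        using y0 u c by (simp add: x_def C power_divide field_simps)
      also have "\<dots> \<le> p ^ d / x"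
        using q x by (intro divide_right_mono power_mono) auto
      finally have "(2 / (C * u) * real q ^ d * y) ^ q \<le> (p ^ d / x) ^ q"
        using y0 u c by (intro power_mono) (auto simp: C)
      then have "(2 / (C * u)) ^ q * (real q ^ d) ^ q * y ^ q \<le> (p ^ d / x) ^ q" by (simp only: power_mult_distrib)
      then show ?thesis using False x pd by (simp add: cut powr_realpow)
    qed
  qed
  also have "\<dots> \<le> 2 * (exp (- p) * (x / p ^ d) powr p) * n * (p ^ d / x) powr (if x < p ^ d then 2 else real q)"
    by (intro mult_right_mono W') simp
  also have "\<dots> = 2 * n * (exp (- p) * (x / p ^ d) powr p * (p ^ d / x) powr (if x < p ^ d then 2 else real q))"
    by simp
  also have "\<dots> \<le> 2 * n * (fact d * min x (1 / x))"
    using p q x n0 by (intro mult_left_mono weight_bound) auto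
  finally show ?thesis by (simp add: x_def mult_ac)
qed

text \<open>Marcinkiewicz interpolation at a single level: \<open>g\<close> is cut at height
  \<open>2 e u / p ^ d\<close>, the upper part is measured in \<open>L\<^sup>2\<close> and the lower one in \<open>L\<^sup>q\<close>,
  where \<open>q \<ge> p + 1\<close> is a power of two.\<close>

lemma fourier_sum_level_bound:
  fixes g :: "real ^ 'd \<Rightarrow> complex" and n :: "real \<Rightarrow> real"
  defines "\<mu> \<equiv> lebesgue_on (torus_box :: (real ^ 'd) set)" and "d \<equiv> CARD('d)"
    and "c \<equiv> 2 * exp 1" and "C \<equiv> 4 * exp 1 * 4 ^ CARD('d)"
  assumes g: "g \<in> borel_measurable \<mu>" and g2: "integrable \<mu> (\<lambda>x. norm (g x) ^ 2)"
    and p: "p \<ge> 3" and s: "s > 0" and u: "u > 0"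
    and W: "0 \<le> W" "W \<le> 2 * (2 * u / (p ^ d * s)) powr p" and n: "\<And>y. y \<ge> 0 \<Longrightarrow> (y / s) powr p \<le> n y"
  shows "ennreal W * emeasure \<mu> {x \<in> space \<mu>. norm (fourier_sum m g x) > C * u}
    \<le> (\<integral>\<^sup>+x. ennreal (2 * fact d * n (norm (g x)) * min (c * u / norm (g x)) (1 / (c * u / norm (g x)))) \<partial>\<mu>)"
proof -
  interpret finite_measure \<mu> unfolding \<mu>_def by (rule finite_measure_torus_box)
  note [measurable] = g
  \<comment> \<open>The bracket yields \<open>q < 2 * (p + 1)\<close>, hence
    \<open>q \<le> 4 * p\<close>, and as a power of two \<open>q\<close> is an exponent covered by
    \<open>fourier_sum_Lp_bound\<close>.\<close>
  have "p + 1 > 2 ^ 0" using p by simp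
  then obtain j where j: "2 ^ j < p + 1" "p + 1 \<le> 2 ^ Suc j" by (rule dyadic_bracket)
  define q :: nat where "q = 2 ^ Suc j"
  have q: "p + 1 \<le> real q" "real q \<le> 4 * p" using j p by (auto simp: q_def)
  define t where "t = c * u / p ^ d"
  define a where "a x = (if norm (g x) > t then g x else 0)" for x
  define b where "b x = (if norm (g x) > t then 0 else g x)" for x
  have [measurable]: "a \<in> borel_measurable \<mu>" "b \<in> borel_measurable \<mu>"
    unfolding a_def b_def by measurable
  have Ta [measurable]: "fourier_sum m h \<in> borel_measurable \<mu>" for h :: "real ^ 'd \<Rightarrow> complex"
    unfolding \<mu>_def by (rule fourier_sum_measurable)
  have a2: "integrable \<mu> (\<lambda>x. norm (a x) ^ 2)"
    by (rule Bochner_Integration.integrable_bound[OF g2]) (auto simp: a_def)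
  have t: "t > 0" using p u by (simp add: t_def c_def)
  have b_le: "norm (b x) \<le> t" for x using t by (simp add: b_def)
  have bq: "integrable \<mu> (\<lambda>x. norm (b x) ^ q)"
    using power_mono[OF b_le norm_ge_zero] by (intro integrable_const_bound[of _ "t ^ q"]) auto
  have a_int: "integrable \<mu> a"
    using torus.integrable_if_power_integrable[of a 2] a2 unfolding \<mu>_def [symmetric] by simp
  have b_int: "integrable \<mu> b"
    using b_le by (intro integrable_const_bound[of _ t]) auto
  have split: "fourier_sum m g x = fourier_sum m a x + fourier_sum m b x" for x
  proof -
    have "g = (\<lambda>x. a x + b x)" by (auto simp: a_def b_def)
    then show ?thesis using fourier_sum_add[of a b m x] a_int b_int by (simp add: \<mu>_def)
  qed
  \<comment> \<open>At exponent 2 the operator bound has constant 1.\<close>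
  have Ta2: "(\<integral>\<^sup>+x. ennreal (norm (fourier_sum m a x) ^ 2) \<partial>\<mu>) \<le> (\<integral>\<^sup>+x. ennreal (norm (a x) ^ 2) \<partial>\<mu>)"
    using fourier_sum_Lp_bound[of a 0 m] a2 by (simp add: \<mu>_def [symmetric])
  have Tbq: "(\<integral>\<^sup>+x. ennreal (norm (fourier_sum m b x) ^ q) \<partial>\<mu>)
    \<le> ennreal ((real q ^ d) ^ q) * (\<integral>\<^sup>+x. ennreal (norm (b x) ^ q) \<partial>\<mu>)"
  proof -
    have "(\<integral>\<^sup>+x. ennreal (norm (fourier_sum m b x) ^ q) \<partial>\<mu>)
      \<le> ennreal (((real q - 1) ^ q) ^ d) * (\<integral>\<^sup>+x. ennreal (norm (b x) ^ q) \<partial>\<mu>)"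
      using fourier_sum_Lp_bound[of b j m] bq by (simp add: \<mu>_def [symmetric] q_def d_def)
    also have "((real q - 1) ^ q) ^ d = ((real q - 1) ^ d) ^ q" by (simp add: power_mult [symmetric] mult.commute)
    also have "ennreal (((real q - 1) ^ d) ^ q) * (\<integral>\<^sup>+x. ennreal (norm (b x) ^ q) \<partial>\<mu>)
      \<le> ennreal ((real q ^ d) ^ q) * (\<integral>\<^sup>+x. ennreal (norm (b x) ^ q) \<partial>\<mu>)"
      using q p by (intro mult_right_mono ennreal_leI power_mono) auto
    finally show ?thesis .
  qed
  define r where "r = 2 / (C * u)"
  have C: "C > 0" by (simp add: C_def)
  have r: "r > 0" using C u by (simp add: r_def)
  define E where "E = {x \<in> space \<mu>. norm (fourier_sum m g x) > C * u}"
  have [measurable]: "E \<in> sets \<mu>" unfolding E_def by measurable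
  have "ennreal W * emeasure \<mu> E = (\<integral>\<^sup>+x. ennreal W * indicator E x \<partial>\<mu>)"
    by (simp add: nn_integral_cmult_indicator)
  also have "\<dots> \<le> (\<integral>\<^sup>+x. ennreal (W * r ^ 2) * ennreal (norm (fourier_sum m a x) ^ 2)
      + ennreal (W * r ^ q) * ennreal (norm (fourier_sum m b x) ^ q) \<partial>\<mu>)"
  proof (intro nn_integral_mono)
    fix x
    define A where "A = r * norm (fourier_sum m a x)"
    define B where "B = r * norm (fourier_sum m b x)"
    have AB: "A \<ge> 0" "B \<ge> 0" using r by (simp_all add: A_def B_def)
    \<comment> \<open>At a point of \<open>E\<close> one of the two pieces is at least half of
      \<open>C * u\<close>, so by the choice of \<open>r\<close> its rescaled size is at least 1.
      This is Chebyshev's inequality for both exponents at once.\<close>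
    have "1 \<le> A ^ 2 + B ^ q" if "x \<in> E"
    proof -
      have "C * u < norm (fourier_sum m a x) + norm (fourier_sum m b x)"
        using that norm_triangle_ineq[of "fourier_sum m a x" "fourier_sum m b x"] by (simp add: E_def split)
      then have "r * (C * u) \<le> A + B" using r by (simp add: A_def B_def distrib_left [symmetric])
      then have "A + B \<ge> 2" using C u by (simp add: r_def)
      then have "A \<ge> 1 \<or> B \<ge> 1" by linarith
      then show ?thesis
        using AB one_le_power[of A 2] one_le_power[of B q] zero_le_power[of A 2] zero_le_power[of B q] by linarith
    qed
    then have "W * indicator E x \<le> W * (A ^ 2 + B ^ q)"
      using W(1) AB by (intro mult_left_mono) (auto simp: indicator_def)
    then have "ennreal (W * indicator E x) \<le> ennreal (W * (A ^ 2 + B ^ q))" by (rule ennreal_leI)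
    also have "W * (A ^ 2 + B ^ q) = (W * r ^ 2) * norm (fourier_sum m a x) ^ 2 + (W * r ^ q) * norm (fourier_sum m b x) ^ q"
      by (simp add: A_def B_def power_mult_distrib algebra_simps)
    finally show "ennreal W * indicator E x \<le> ennreal (W * r ^ 2) * ennreal (norm (fourier_sum m a x) ^ 2)
      + ennreal (W * r ^ q) * ennreal (norm (fourier_sum m b x) ^ q)"
      using W(1) r by (auto simp: ennreal_mult ennreal_plus indicator_def split: if_splits)
  qed
  also have "\<dots> = ennreal (W * r ^ 2) * (\<integral>\<^sup>+x. ennreal (norm (fourier_sum m a x) ^ 2) \<partial>\<mu>)
      + ennreal (W * r ^ q) * (\<integral>\<^sup>+x. ennreal (norm (fourier_sum m b x) ^ q) \<partial>\<mu>)"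
    by (simp add: nn_integral_add nn_integral_cmult)
  also have "\<dots> \<le> ennreal (W * r ^ 2) * (\<integral>\<^sup>+x. ennreal (norm (a x) ^ 2) \<partial>\<mu>)
      + ennreal (W * r ^ q) * (ennreal ((real q ^ d) ^ q) * (\<integral>\<^sup>+x. ennreal (norm (b x) ^ q) \<partial>\<mu>))"
    by (intro add_mono mult_left_mono Ta2 Tbq) auto
  also have "\<dots> = (\<integral>\<^sup>+x. ennreal (W * r ^ 2) * ennreal (norm (a x) ^ 2)
      + ennreal (W * r ^ q) * (ennreal ((real q ^ d) ^ q) * ennreal (norm (b x) ^ q)) \<partial>\<mu>)"
    by (simp add: nn_integral_add nn_integral_cmult)
  also have "\<dots> \<le> (\<integral>\<^sup>+x. ennreal (2 * fact d * n (norm (g x)) * min (c * u / norm (g x)) (1 / (c * u / norm (g x)))) \<partial>\<mu>)"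
  proof (intro nn_integral_mono)
    fix x
    define y where "y = norm (g x)"
    have na: "norm (a x) = (if y > t then y else 0)" and nb: "norm (b x) = (if y > t then 0 else y)"
      by (auto simp: a_def b_def y_def)
    have "ennreal (W * r ^ 2) * ennreal (norm (a x) ^ 2)
      + ennreal (W * r ^ q) * (ennreal ((real q ^ d) ^ q) * ennreal (norm (b x) ^ q))
      = ennreal ((W * r ^ 2) * norm (a x) ^ 2 + (W * r ^ q) * ((real q ^ d) ^ q * norm (b x) ^ q))"
      using W(1) r by (simp only: ennreal_plus ennreal_mult mult_nonneg_nonneg zero_le_power norm_ge_zero
        of_nat_0_le_iff less_imp_le)
    also have "(W * r ^ 2) * norm (a x) ^ 2 + (W * r ^ q) * ((real q ^ d) ^ q * norm (b x) ^ q)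
      = W * (r ^ 2 * (if y > t then y else 0) ^ 2 + r ^ q * (real q ^ d) ^ q * (if y > t then 0 else y) ^ q)"
      unfolding na nb by (simp only: distrib_left mult.assoc)
    also have "\<dots> \<le> 2 * fact d * n y * min (c * u / y) (1 / (c * u / y))"
      unfolding r_def t_def c_def C_def d_def
      using p s u q W n[of y] by (intro interpolation_weight_bound) (auto simp: d_def y_def)
    finally show "ennreal (W * r ^ 2) * ennreal (norm (a x) ^ 2)
      + ennreal (W * r ^ q) * (ennreal ((real q ^ d) ^ q) * ennreal (norm (b x) ^ q))
      \<le> ennreal (2 * fact d * n (norm (g x)) * min (c * u / norm (g x)) (1 / (c * u / norm (g x))))"
      by (simp add: y_def ennreal_leI)
  qed
  finally show ?thesis by (simp add: E_def)
qed

section \<open>From levels to the modular and the norm\<close>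

text \<open>The range of the rescaled partial sum beyond \<open>2 ^ k\<close> is split dyadically,
  and on each level \<open>N\<^sub>d\<close> is replaced by its value at the upper end.
  \<open>fourier_sum_level_bound\<close> turns every level into an integral of
  \<open>n (norm (g x))\<close> against a weight, and at each point the weights have a bounded sum.
  \<open>B\<close> is obtained before \<open>N\<close>, \<open>N\<^sub>d\<close>, \<open>g\<close>
  and \<open>m\<close>, hence is uniform in them.\<close>

lemma fourier_sum_modular_bound:
  assumes \<alpha>: "\<alpha> \<ge> 1" and \<psi>: "\<psi> \<in> Psi_class \<alpha>"
  defines "\<mu> \<equiv> lebesgue_on (torus_box :: (real ^ 'd) set)"
    and "C \<equiv> 4 * exp 1 * 4 ^ CARD('d)"
  obtains B where "B \<ge> 0" and
    "\<And>N N\<^sub>d (g :: real ^ 'd \<Rightarrow> complex) m. is_orlicz_fun \<alpha> \<psi> N \<Longrightarrow> is_orlicz_fun \<alpha> (psi_pow CARD('d) \<psi>) N\<^sub>d \<Longrightarrow>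
      g \<in> borel_measurable \<mu> \<Longrightarrow> (\<integral>\<^sup>+x. ennreal (N (norm (g x))) \<partial>\<mu>) \<le> 1 \<Longrightarrow>
      integrable \<mu> g \<and> (\<integral>\<^sup>+x. ennreal (N\<^sub>d (norm (fourier_sum m g x) / C)) \<partial>\<mu>) \<le> ennreal B"
proof -
  interpret finite_measure \<mu> unfolding \<mu>_def by (rule finite_measure_torus_box)
  define d where "d = CARD('d)"
  define V where "V = measure \<mu> (space \<mu>)"
  have V: "emeasure \<mu> (space \<mu>) = ennreal V" by (simp add: V_def emeasure_eq_measure)
  have V0: "V \<ge> 0" by (simp add: V_def)
  define c :: real where "c = 2 * exp 1"
  have C: "C > 0" by (simp add: C_def)
  obtain k :: nat where "k \<ge> 4" and
    near_max: "\<forall>N v. is_orlicz_fun \<alpha> (psi_pow d \<psi>) N \<longrightarrow> v \<ge> 2 ^ k \<longrightarrow>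
      (\<exists>p\<ge>\<alpha>. p \<ge> 3 \<and> N v \<le> 2 * (v / (p ^ d * \<psi> p)) powr p)"
    using orlicz_fun_near_maximiser[OF \<alpha> \<psi>, of d] by (elim exE conjE)
  \<comment> \<open>From \<open>exp 2\<close> on all admissible versions agree with the supremum
    formula, so constants expressed by \<open>star\<close> do not depend on the version.\<close>
  define star where "star \<phi> u = exp (SUP p\<in>{\<alpha>..}. p * ln \<bar>u\<bar> - p * ln (\<phi> p))" for \<phi> and u :: real
  have star: "N u = star \<phi> u" if "is_orlicz_fun \<alpha> \<phi> N" "u \<ge> exp 2" for N \<phi> u
  proof -
    have "u \<ge> 0" using that(2) exp_ge_zero[of "2 :: real"] by (rule order_trans[rotated])
    then show ?thesis using that by (simp add: is_orlicz_fun_def star_def)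
  qed
  have exp2: "exp 2 \<le> (2 :: real) ^ k"
  proof -
    have "exp (2 :: real) = exp 1 ^ 2" using exp_double[of "1 :: real"] by simp
    also have "\<dots> \<le> (3::real) ^ 2" using exp_le by (intro power_mono) auto
    also have "\<dots> \<le> 2 ^ 4" by simp
    also have "\<dots> \<le> 2 ^ k" using \<open>k \<ge> 4\<close> by (intro power_increasing) auto
    finally show ?thesis .
  qed
  define K where "K = star \<psi> (exp 2)"
  have K0: "K \<ge> 0" by (simp add: K_def star_def)
  \<comment> \<open>The first term pays for values up to \<open>2 ^ k\<close>. In the second,
    \<open>1 + K * V\<close> will bound the integral of the majorant, and 8 is the factor 2 of the
    level bound times the constant 4 of the dyadic sum.\<close>
  define B where "B = star (psi_pow d \<psi>) (2 ^ k) * V + 8 * fact d * (1 + K * V)"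
  have B0: "B \<ge> 0" using V0 K0 by (simp add: B_def star_def)
  have bound: "integrable \<mu> g \<and> (\<integral>\<^sup>+x. ennreal (N\<^sub>d (norm (fourier_sum m g x) / C)) \<partial>\<mu>) \<le> ennreal B"
    if N: "is_orlicz_fun \<alpha> \<psi> N" and Nd: "is_orlicz_fun \<alpha> (psi_pow CARD('d) \<psi>) N\<^sub>d"
      and g [measurable]: "g \<in> borel_measurable \<mu>" and mod: "(\<integral>\<^sup>+x. ennreal (N (norm (g x))) \<partial>\<mu>) \<le> 1"
    for N N\<^sub>d m and g :: "real ^ 'd \<Rightarrow> complex"
  proof -
    have Nd': "is_orlicz_fun \<alpha> (psi_pow d \<psi>) N\<^sub>d" using Nd by (simp add: d_def)
    define n where "n y = N y + K" for y
    have n: "(y / \<psi> p) powr p \<le> n y" if "p \<ge> \<alpha>" "y \<ge> 0" for p y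
      using orlicz_fun_majorant[OF \<alpha> \<psi> N that] star[OF N, of "exp 2"] by (simp add: n_def K_def)
    have N0: "N y \<ge> 0" for y by (rule orlicz_fun_nonneg[OF N])
    have n0: "n y \<ge> 0" for y using N0[of y] K0 by (simp add: n_def)
    have [measurable]: "N \<in> borel_measurable borel" "N\<^sub>d \<in> borel_measurable borel"
      using N Nd by (auto simp: is_orlicz_fun_def intro: borel_measurable_continuous_onI)
    have [measurable]: "n \<in> borel_measurable borel" unfolding n_def by measurable
    have int_n: "(\<integral>\<^sup>+x. ennreal (n (norm (g x))) \<partial>\<mu>) \<le> ennreal (1 + K * V)"
    proof -
      have "(\<integral>\<^sup>+x. ennreal (n (norm (g x))) \<partial>\<mu>) = (\<integral>\<^sup>+x. ennreal (N (norm (g x))) \<partial>\<mu>) + ennreal K * ennreal V"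
        using N0 K0 by (simp add: n_def ennreal_plus nn_integral_add V)
      also have "\<dots> \<le> 1 + ennreal K * ennreal V" by (intro add_right_mono mod)
      also have "\<dots> = ennreal (1 + K * V)" using K0 V0 by (simp add: ennreal_plus ennreal_mult)
      finally show ?thesis .
    qed
    have integrable_n: "integrable \<mu> (\<lambda>x. n (norm (g x)))"
      using int_n n0 by (intro integrableI_nonneg) (auto simp: less_top [symmetric] top_unique elim: order.strict_trans1)
    have g2: "integrable \<mu> (\<lambda>x. norm (g x) ^ 2)"
    proof -
      \<comment> \<open>The majorant holds from \<open>\<alpha>\<close> on only, while square
        integrability needs an exponent of at least 2.\<close>
      define p where "p = max 2 \<alpha>"
      define s where "s = \<psi> p"
      have p: "p \<ge> \<alpha>" "p \<ge> 2" by (simp_all add: p_def)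
      have s: "s > 0" using Psi_class_pos[OF \<psi> p(1)] by (simp add: s_def)
      have "norm (g x) ^ 2 \<le> 1 + s powr p * n (norm (g x))" for x
      proof (cases "norm (g x) \<le> 1")
        case True
        then have "norm (g x) ^ 2 \<le> 1" by (simp add: power_le_one)
        then show ?thesis using n0[of "norm (g x)"] by (simp add: add_increasing2)
      next
        case False
        then have "norm (g x) ^ 2 = norm (g x) powr 2" by (simp add: powr_numeral)
        also have "\<dots> \<le> norm (g x) powr p" using False p by (intro powr_mono) auto
        also have "\<dots> = s powr p * (norm (g x) / s) powr p"
          using s by (simp add: powr_mult [symmetric])
        also have "\<dots> \<le> s powr p * n (norm (g x))"
          using n[OF p(1), of "norm (g x)"] by (intro mult_left_mono) (auto simp: s_def)
        finally show ?thesis by simp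
      qed
      then have le: "norm (norm (g x) ^ 2) \<le> norm (1 + s powr p * n (norm (g x)))" for x
        using abs_ge_self order_trans by (simp add: real_norm_def) blast
      have "integrable \<mu> (\<lambda>x. 1 + s powr p * n (norm (g x)))" using integrable_n by simp
      then show ?thesis by (rule Bochner_Integration.integrable_bound) (simp_all only: le AE_I2, measurable)
    qed
    have "integrable \<mu> g"
      unfolding \<mu>_def by (rule torus.integrable_if_power_integrable[of _ 2]) (use g g2 in \<open>simp_all add: \<mu>_def\<close>)
    moreover have "(\<integral>\<^sup>+x. ennreal (N\<^sub>d (norm (fourier_sum m g x) / C)) \<partial>\<mu>) \<le> ennreal B"
    proof -
      define E where "E i = {x \<in> space \<mu>. norm (fourier_sum m g x) > C * 2 ^ (k + i)}" for i
      define w where "w i x = 2 * fact d * n (norm (g x)) *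
        min (c * 2 ^ (k + i) / norm (g x)) (1 / (c * 2 ^ (k + i) / norm (g x)))" for i x
      have [measurable]: "fourier_sum m g \<in> borel_measurable \<mu>"
        unfolding \<mu>_def by (rule fourier_sum_measurable)
      have [measurable]: "E i \<in> sets \<mu>" for i unfolding E_def by measurable
      have [measurable]: "w i \<in> borel_measurable \<mu>" for i unfolding w_def by measurable
      have level: "ennreal (N\<^sub>d (2 ^ Suc (k + i))) * emeasure \<mu> (E i) \<le> (\<integral>\<^sup>+x. ennreal (w i x) \<partial>\<mu>)" for i
      proof -
        have "(2::real) ^ Suc (k + i) \<ge> 2 ^ k" by (intro power_increasing) auto
        then obtain p where p: "p \<ge> \<alpha>" "p \<ge> 3" "N\<^sub>d (2 ^ Suc (k + i)) \<le> 2 * (2 ^ Suc (k + i) / (p ^ d * \<psi> p)) powr p"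
          using near_max[rule_format, OF Nd'] by blast
        show ?thesis
          unfolding E_def w_def \<mu>_def C_def c_def d_def
          by (rule fourier_sum_level_bound[where p = p and s = "\<psi> p"])
            (use p g g2 Psi_class_pos[OF \<psi> p(1)] n[OF p(1)] orlicz_fun_nonneg[OF Nd]
              in \<open>simp_all add: \<mu>_def [symmetric] d_def [symmetric]\<close>)
      qed
      \<comment> \<open>Tonelli moves the sum over levels inside, where at each point the arguments
        form the geometric sequence \<open>y * 2 ^ i\<close>.\<close>
      have "(\<Sum>i. \<integral>\<^sup>+x. ennreal (w i x) \<partial>\<mu>) = (\<integral>\<^sup>+x. (\<Sum>i. ennreal (w i x)) \<partial>\<mu>)"
        by (rule nn_integral_suminf [symmetric]) measurable
      also have "\<dots> \<le> (\<integral>\<^sup>+x. ennreal (8 * fact d) * ennreal (n (norm (g x))) \<partial>\<mu>)"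
      proof (intro nn_integral_mono)
        fix x
        define y where "y = c * 2 ^ k / norm (g x)"
        have y: "y \<ge> 0" by (simp add: y_def c_def)
        have "w i x = (2 * fact d * n (norm (g x))) * min (y * 2 ^ i) (1 / (y * 2 ^ i))" for i
          by (simp add: w_def y_def power_add mult_ac)
        then have "(\<Sum>i. ennreal (w i x)) = (\<Sum>i. ennreal (2 * fact d * n (norm (g x))) * ennreal (min (y * 2 ^ i) (1 / (y * 2 ^ i))))"
          using y n0 by (simp add: ennreal_mult)
        also have "\<dots> = ennreal (2 * fact d * n (norm (g x))) * (\<Sum>i. ennreal (min (y * 2 ^ i) (1 / (y * 2 ^ i))))"
          by (rule ennreal_suminf_cmult)
        also have "\<dots> \<le> ennreal (2 * fact d * n (norm (g x))) * ennreal 4"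
          using suminf_min_geometric_le[OF y] by (intro mult_left_mono) auto
        also have "\<dots> = ennreal (8 * fact d) * ennreal (n (norm (g x)))"
          using n0[of "norm (g x)"] by (subst (1 2) ennreal_mult [symmetric]) (auto simp: mult_ac)
        finally show "(\<Sum>i. ennreal (w i x)) \<le> ennreal (8 * fact d) * ennreal (n (norm (g x)))" .
      qed
      also have "\<dots> = ennreal (8 * fact d) * (\<integral>\<^sup>+x. ennreal (n (norm (g x))) \<partial>\<mu>)"
        by (rule nn_integral_cmult) measurable
      also have "\<dots> \<le> ennreal (8 * fact d) * ennreal (1 + K * V)"
        by (intro mult_left_mono int_n) auto
      finally have tail: "(\<Sum>i. \<integral>\<^sup>+x. ennreal (w i x) \<partial>\<mu>) \<le> ennreal (8 * fact d) * ennreal (1 + K * V)" .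
      \<comment> \<open>Values up to \<open>2 ^ k\<close> are covered by the constant term, every
        other one by the single series term of the dyadic level that contains it.\<close>
      have "(\<integral>\<^sup>+x. ennreal (N\<^sub>d (norm (fourier_sum m g x) / C)) \<partial>\<mu>)
        \<le> (\<integral>\<^sup>+x. ennreal (N\<^sub>d (2 ^ k)) + (\<Sum>i. ennreal (N\<^sub>d (2 ^ Suc (k + i))) * indicator (E i) x) \<partial>\<mu>)"
      proof (intro nn_integral_mono)
        fix x assume x: "x \<in> space \<mu>"
        define h where "h = norm (fourier_sum m g x) / C"
        have h0: "h \<ge> 0" using C by (simp add: h_def)
        show "ennreal (N\<^sub>d (norm (fourier_sum m g x) / C))
          \<le> ennreal (N\<^sub>d (2 ^ k)) + (\<Sum>i. ennreal (N\<^sub>d (2 ^ Suc (k + i))) * indicator (E i) x)"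
        proof (cases "h \<le> 2 ^ k")
          case True
          then have "N\<^sub>d h \<le> N\<^sub>d (2 ^ k)" using h0 by (intro orlicz_fun_mono[OF Nd]) auto
          then show ?thesis by (simp add: h_def [symmetric] ennreal_leI add_increasing2)
        next
          case False
          then obtain j where j: "j \<ge> k" "2 ^ j < h" "h \<le> 2 ^ Suc j"
            using dyadic_bracket[of k h] by auto
          define i where "i = j - k"
          have i: "j = k + i" using j(1) by (simp add: i_def)
          have "x \<in> E i" using x j(2) C by (simp add: E_def i h_def field_simps)
          then have "ennreal (N\<^sub>d h) \<le> ennreal (N\<^sub>d (2 ^ Suc (k + i))) * indicator (E i) x"
            using orlicz_fun_mono[OF Nd h0 j(3)] by (simp add: i ennreal_leI)
          also have "\<dots> \<le> (\<Sum>i. ennreal (N\<^sub>d (2 ^ Suc (k + i))) * indicator (E i) x)"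
          proof -
            have "F i \<le> (\<Sum>i. F i)" for F :: "nat \<Rightarrow> ennreal"
              using sum_le_suminf[OF summableI, of "{i}" F] by simp
            then show ?thesis .
          qed
          finally show ?thesis by (simp add: h_def [symmetric] add_increasing)
        qed
      qed
      also have "\<dots> = ennreal (N\<^sub>d (2 ^ k)) * ennreal V + (\<Sum>i. ennreal (N\<^sub>d (2 ^ Suc (k + i))) * emeasure \<mu> (E i))"
        by (simp add: nn_integral_add nn_integral_suminf nn_integral_cmult_indicator V)
      also have "\<dots> \<le> ennreal (N\<^sub>d (2 ^ k)) * ennreal V + (\<Sum>i. \<integral>\<^sup>+x. ennreal (w i x) \<partial>\<mu>)"
        by (intro add_left_mono suminf_le level summableI)
      also have "\<dots> \<le> ennreal (N\<^sub>d (2 ^ k)) * ennreal V + ennreal (8 * fact d) * ennreal (1 + K * V)"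
        by (intro add_left_mono tail)
      also have "\<dots> = ennreal B"
      proof -
        have "ennreal a * ennreal V + ennreal b * ennreal z = ennreal (a * V + b * z)"
          if "0 \<le> a" "0 \<le> b" "0 \<le> z" for a b z
          using that V0 by (simp add: ennreal_plus ennreal_mult)
        from this[of "N\<^sub>d (2 ^ k)" "8 * fact d" "1 + K * V"] show ?thesis
          unfolding B_def star[OF Nd' exp2, symmetric] using orlicz_fun_nonneg[OF Nd] K0 V0 by simp
      qed
      finally show ?thesis .
    qed
    ultimately show ?thesis by blast
  qed
  show ?thesis by (rule that[OF B0]) (rule bound)
qed

text \<open>For a \<open>v\<close> whose modular \<open>J\<close> is finite, dividing by
  \<open>I = 1 + J\<close> brings the modular down to at most 1, because convexity and
  \<open>N 0 = 0\<close> give \<open>N (y / I) \<le> N y / I\<close>. Testing the norm of the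
  partial sum at \<open>t / C\<close> then returns exactly the factor \<open>(1 + J) / v\<close>,
  and the infimum over \<open>v\<close> is the norm of \<open>f\<close>.\<close>

lemma orlicz_norm_fourier_sum_le:
  fixes f :: "real ^ 'd \<Rightarrow> complex"
  defines "\<mu> \<equiv> lebesgue_on (torus_box :: (real ^ 'd) set)"
  assumes N: "is_orlicz_fun \<alpha> \<psi> N" and C: "C > 0" and B: "B \<ge> 0"
    and modular: "\<And>g :: real ^ 'd \<Rightarrow> complex. g \<in> borel_measurable \<mu> \<Longrightarrow> (\<integral>\<^sup>+x. ennreal (N (norm (g x))) \<partial>\<mu>) \<le> 1 \<Longrightarrow>
      integrable \<mu> g \<and> (\<integral>\<^sup>+x. ennreal (N' (norm (fourier_sum m g x) / C)) \<partial>\<mu>) \<le> ennreal B"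
    and f: "f \<in> borel_measurable \<mu>"
  shows "orlicz_norm \<mu> N' (fourier_sum m f) \<le> ennreal (C * (1 + B)) * orlicz_norm \<mu> N f"
proof -
  note [measurable] = f
  have [measurable]: "N \<in> borel_measurable borel"
    using N by (auto simp: is_orlicz_fun_def intro: borel_measurable_continuous_onI)
  have N0: "N y \<ge> 0" for y by (rule orlicz_fun_nonneg[OF N])
  have main: "orlicz_norm \<mu> N' (fourier_sum m f)
    \<le> ennreal (C * (1 + B)) * (ennreal (1 / v) * (1 + (\<integral>\<^sup>+x. ennreal (N (v * norm (f x))) \<partial>\<mu>)))" if v: "v > 0" for v
  proof (cases "\<integral>\<^sup>+x. ennreal (N (v * norm (f x))) \<partial>\<mu>")
    case (real J)
    define I where "I = 1 + J"
    have I: "I \<ge> 1" using real by (simp add: I_def)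
    define t where "t = v / I"
    have t: "t > 0" using v I by (simp add: t_def)
    define g where "g x = complex_of_real t * f x" for x
    have [measurable]: "g \<in> borel_measurable \<mu>" unfolding g_def by measurable
    have norm_g: "norm (g x) = t * norm (f x)" for x using t by (simp add: g_def norm_mult)
    have "N (norm (g x)) \<le> (1 / I) * N (v * norm (f x))" for x
    proof -
      have "convex_on UNIV N" "N 0 = 0" using N by (auto simp: is_orlicz_fun_def)
      then have "N ((1 - 1 / I) *\<^sub>R 0 + (1 / I) *\<^sub>R (v * norm (f x))) \<le> (1 - 1 / I) * N 0 + (1 / I) * N (v * norm (f x))"
        using I by (intro convex_onD) auto
      then show ?thesis using \<open>N 0 = 0\<close> by (simp add: norm_g t_def)
    qed
    then have "(\<integral>\<^sup>+x. ennreal (N (norm (g x))) \<partial>\<mu>) \<le> (\<integral>\<^sup>+x. ennreal (1 / I) * ennreal (N (v * norm (f x))) \<partial>\<mu>)"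
      using I N0 by (intro nn_integral_mono) (simp add: ennreal_mult' [symmetric] ennreal_leI)
    also have "\<dots> = ennreal (1 / I) * ennreal J" using real by (simp add: nn_integral_cmult)
    also have "\<dots> \<le> 1" using real I by (simp add: ennreal_mult' [symmetric] I_def ennreal_le_1)
    finally have g: "integrable \<mu> g" "(\<integral>\<^sup>+x. ennreal (N' (norm (fourier_sum m g x) / C)) \<partial>\<mu>) \<le> ennreal B"
      using modular[of g] by auto
    have f_eq: "f = (\<lambda>x. complex_of_real (1 / t) * g x)" using t by (simp add: g_def)
    have Tf: "norm (fourier_sum m f x) = norm (fourier_sum m g x) / t" for x
      using fourier_sum_cmult[OF g(1)[unfolded \<mu>_def], of m "complex_of_real (1 / t)" x] t
      by (simp only: f_eq [symmetric] norm_mult norm_of_real) simp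
    have "orlicz_norm \<mu> N' (fourier_sum m f)
      \<le> ennreal (1 / (t / C)) * (1 + (\<integral>\<^sup>+x. ennreal (N' (t / C * norm (fourier_sum m f x))) \<partial>\<mu>))"
      unfolding orlicz_norm_def using t C by (intro INF_lower) auto
    also have "\<dots> \<le> ennreal (1 / (t / C)) * (1 + ennreal B)"
      using g(2) t by (intro mult_left_mono add_left_mono) (auto simp: Tf)
    also have "\<dots> = ennreal (C * (1 + B)) * (ennreal (1 / v) * (1 + ennreal J))"
    proof -
      have nonneg: "0 \<le> 1 / (t / C)" "0 \<le> 1 + B" "0 \<le> C * (1 + B)" "0 \<le> 1 / v" "0 \<le> 1 + J" "0 \<le> 1 / v * (1 + J)"
        using B C t v real by simp_all
      have "ennreal (1 / (t / C)) * (1 + ennreal B) = ennreal (1 / (t / C)) * ennreal (1 + B)"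
        using B by (simp add: ennreal_plus)
      also have "\<dots> = ennreal (1 / (t / C) * (1 + B))"
        by (rule ennreal_mult [symmetric, OF nonneg(1,2)])
      also have "1 / (t / C) * (1 + B) = C * (1 + B) * (1 / v * (1 + J))"
        by (simp add: t_def I_def)
      also have "ennreal \<dots> = ennreal (C * (1 + B)) * (ennreal (1 / v) * ennreal (1 + J))"
        by (simp only: ennreal_mult[OF nonneg(3,6)] ennreal_mult[OF nonneg(4,5)])
      also have "ennreal (1 + J) = 1 + ennreal J" using real by (simp add: ennreal_plus)
      finally show ?thesis .
    qed
    finally show ?thesis using real by simp
  next
    \<comment> \<open>An infinite modular makes the right-hand side infinite.\<close>
    case top
    then show ?thesis using v C B by (simp add: ennreal_mult_eq_top_iff ennreal_mult_top)
  qed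
  define L where "L = C * (1 + B)"
  have L: "L > 0" using C B by (simp add: L_def)
  \<comment> \<open>The factor \<open>L\<close> is moved to the other side, so that
    \<open>INF_greatest\<close> applies to a bare infimum; cancellation in \<open>ennreal\<close>
    rests on \<open>L\<close> being positive and finite.\<close>
  have cancel: "ennreal (1 / L) * (ennreal L * z) = z" "ennreal L * (ennreal (1 / L) * z) = z" for z
    using L by (simp_all add: mult.assoc [symmetric] ennreal_mult' [symmetric])
  have "ennreal (1 / L) * orlicz_norm \<mu> N' (fourier_sum m f) \<le> orlicz_norm \<mu> N f"
    unfolding orlicz_norm_def[of \<mu> N f]
  proof (rule INF_greatest)
    fix v :: real assume "v \<in> {0<..}"
    then have "ennreal (1 / L) * orlicz_norm \<mu> N' (fourier_sum m f) \<le> ennreal (1 / L) *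
      (ennreal L * (ennreal (1 / v) * (1 + (\<integral>\<^sup>+x. ennreal (N (v * norm (f x))) \<partial>\<mu>))))"
      unfolding L_def by (intro mult_left_mono main) auto
    then show "ennreal (1 / L) * orlicz_norm \<mu> N' (fourier_sum m f)
      \<le> ennreal (1 / v) * (1 + (\<integral>\<^sup>+x. ennreal (N (v * norm (f x))) \<partial>\<mu>))" by (simp only: cancel)
  qed
  then have "ennreal L * (ennreal (1 / L) * orlicz_norm \<mu> N' (fourier_sum m f)) \<le> ennreal L * orlicz_norm \<mu> N f"
    by (rule mult_left_mono) simp
  then show ?thesis by (simp only: cancel L_def [symmetric])
qed

theorem theorem1:
  fixes \<alpha> :: real and \<psi> :: "real \<Rightarrow> real"
  assumes "\<alpha> \<ge> 1" and "\<psi> \<in> Psi_class \<alpha>"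
  shows "\<exists>C::real. C \<ge> 0 \<and>
    (\<forall>N N\<^sub>d. is_orlicz_fun \<alpha> \<psi> N \<longrightarrow> is_orlicz_fun \<alpha> (psi_pow CARD('d::finite) \<psi>) N\<^sub>d \<longrightarrow>
      (\<forall>f :: real ^ 'd \<Rightarrow> complex. f \<in> orlicz_space (lebesgue_on torus_box) N \<longrightarrow>
        (\<forall>M\<ge>1. fourier_sum M f \<in> orlicz_space (lebesgue_on torus_box) N\<^sub>d) \<and>
        (SUP M\<in>{1..}. orlicz_norm (lebesgue_on torus_box) N\<^sub>d (fourier_sum M f))
          \<le> ennreal C * orlicz_norm (lebesgue_on torus_box) N f))"
proof -
  define c :: real where "c = 4 * exp 1 * 4 ^ CARD('d)"
  have c: "c > 0" by (simp add: c_def)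
  obtain B where B: "B \<ge> 0" and
    modular: "\<And>N N\<^sub>d (g :: real ^ 'd \<Rightarrow> complex) m. is_orlicz_fun \<alpha> \<psi> N \<Longrightarrow> is_orlicz_fun \<alpha> (psi_pow CARD('d) \<psi>) N\<^sub>d \<Longrightarrow>
      g \<in> borel_measurable (lebesgue_on torus_box) \<Longrightarrow> (\<integral>\<^sup>+x. ennreal (N (norm (g x))) \<partial>lebesgue_on torus_box) \<le> 1 \<Longrightarrow>
      integrable (lebesgue_on torus_box) g \<and>
      (\<integral>\<^sup>+x. ennreal (N\<^sub>d (norm (fourier_sum m g x) / c)) \<partial>lebesgue_on torus_box) \<le> ennreal B"
    using fourier_sum_modular_bound[OF assms, where 'd = 'd] unfolding c_def by metis
  have bound: "orlicz_norm (lebesgue_on torus_box) N\<^sub>d (fourier_sum M f)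
      \<le> ennreal (c * (1 + B)) * orlicz_norm (lebesgue_on torus_box) N f"
    if "is_orlicz_fun \<alpha> \<psi> N" "is_orlicz_fun \<alpha> (psi_pow CARD('d) \<psi>) N\<^sub>d"
      "f \<in> orlicz_space (lebesgue_on torus_box) N" for N N\<^sub>d M and f :: "real ^ 'd \<Rightarrow> complex"
    using that by (intro orlicz_norm_fourier_sum_le[OF that(1) c B] modular) (auto simp: orlicz_space_def)
  have mem: "fourier_sum M f \<in> orlicz_space (lebesgue_on torus_box) N\<^sub>d"
    if "is_orlicz_fun \<alpha> \<psi> N" "is_orlicz_fun \<alpha> (psi_pow CARD('d) \<psi>) N\<^sub>d"
      "f \<in> orlicz_space (lebesgue_on torus_box) N" for N N\<^sub>d M and f :: "real ^ 'd \<Rightarrow> complex"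
  proof -
    have "ennreal (c * (1 + B)) * orlicz_norm (lebesgue_on torus_box) N f < \<infinity>"
      using that(3) by (simp add: orlicz_space_def ennreal_mult_less_top)
    then show ?thesis
      using order.strict_trans1[OF bound[OF that]] by (simp add: orlicz_space_def fourier_sum_measurable)
  qed
  show ?thesis
  \<comment> \<open>The constant is fixed before \<open>N\<close>, \<open>N\<^sub>d\<close> and
    \<open>f\<close>: \<open>c\<close> depends on the dimension alone, and \<open>B\<close> was
    obtained from \<open>\<alpha>\<close>, \<open>\<psi>\<close> and the dimension.\<close>
  proof (intro exI[of _ "c * (1 + B)"] conjI allI impI)
    show "c * (1 + B) \<ge> 0" using c B by simp
  qed (auto intro: mem SUP_least bound)
qed

end
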